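(* Let $s,t,p\ge 1$, $A,B\in GL(n)$, $Q\in\mathcal{P}(n)$, and put $c_1=\max\{\lambda_1^{1/t}(AQ^{-1}A^* ),\;\lambda_1^{1/p}(BQ^{-1}B^* )\}$. Suppose there exists $k>0$ such that $k^{-t}+k^{-p}<1$ and $$\lambda_1(c_1^sQ^{-1})\le(1-k^{-t}-k^{-p})k^{-s}.$$ Then $kc_1I\le Q^{1/s}$ and the equation $X^s+A^*X^{-t}A+B^*X^{-p}B=Q$ has a Hermitian positive definite solution in $[kc_1I,Q^{1/s}]$. Furthermore, if $$\frac1s(kc_1)^{1-s}\Big[\frac{t}{(kc_1)^{t+1}}\|A\|^2+\frac{p}{(kc_1)^{p+1}}\|B\|^2\Big]<1,$$ then this solution is the unique solution in $[kc_1I,Q^{1/s}]$.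
   Context: $GL(n)$: $n\times n$ complex nonsingular matrices; $\mathcal{P}(n)$: $n\times n$ Hermitian positive definite matrices. For Hermitian $M$, $\lambda_1(M)$ is its largest eigenvalue. $\|\cdot\|$ is the spectral norm. For Hermitian $P,R$, $P\le R$ means $R-P$ is positive semidefinite, and $[P,R]=\{X \text{ Hermitian}: P\le X\le R\}$. Real powers of positive definite matrices are defined by functional calculus. *)

theory Defs
  imports Complex_Main "Jordan_Normal_Form.Schur_Decomposition"
begin

definition GL :: "nat \<Rightarrow> complex mat set" where
  "GL n = {A. A \<in> carrier_mat n n \<and> invertible_mat A}"

definition minv :: "complex mat \<Rightarrow> complex mat" where
  "minv A = (SOME B. B \<in> carrier_mat (dim_row A) (dim_row A) \<and>
      A * B = 1\<^sub>m (dim_row A) \<and> B * A = 1\<^sub>m (dim_row A))"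

definition hermitian_mat :: "nat \<Rightarrow> complex mat \<Rightarrow> bool" where
  "hermitian_mat n M \<longleftrightarrow> M \<in> carrier_mat n n \<and> mat_adjoint M = M"

text \<open>Quadratic form v^* M v is (M v) \<bullet>c v.\<close>
definition psd_mat :: "nat \<Rightarrow> complex mat \<Rightarrow> bool" where
  "psd_mat n M \<longleftrightarrow> hermitian_mat n M \<and>
     (\<forall>v \<in> carrier_vec n. Re ((M *\<^sub>v v) \<bullet>c v) \<ge> 0)"

definition pd_mat :: "nat \<Rightarrow> complex mat \<Rightarrow> bool" where
  "pd_mat n M \<longleftrightarrow> hermitian_mat n M \<and>
     (\<forall>v \<in> carrier_vec n. v \<noteq> 0\<^sub>v n \<longrightarrow> Re ((M *\<^sub>v v) \<bullet>c v) > 0)"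

definition loewner_le :: "nat \<Rightarrow> complex mat \<Rightarrow> complex mat \<Rightarrow> bool" where
  "loewner_le n P R \<longleftrightarrow> hermitian_mat n P \<and> hermitian_mat n R \<and> psd_mat n (R - P)"

definition loewner_interval :: "nat \<Rightarrow> complex mat \<Rightarrow> complex mat \<Rightarrow> complex mat set" where
  "loewner_interval n P R = {X. hermitian_mat n X \<and> loewner_le n P X \<and> loewner_le n X R}"

definition unitary_mat :: "nat \<Rightarrow> complex mat \<Rightarrow> bool" where
  "unitary_mat n U \<longleftrightarrow> U \<in> carrier_mat n n \<and> mat_adjoint U * U = 1\<^sub>m n"

definition mpow :: "complex mat \<Rightarrow> real \<Rightarrow> complex mat" where
  "mpow M r = (THE X. \<exists>U (d :: nat \<Rightarrow> real). unitary_mat (dim_row M) U \<and>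
      (\<forall>i < dim_row M. d i > 0) \<and>
      M = U * mat_diag (dim_row M) (\<lambda>i. complex_of_real (d i)) * mat_adjoint U \<and>
      X = U * mat_diag (dim_row M) (\<lambda>i. complex_of_real (d i powr r)) * mat_adjoint U)"

text \<open>Largest eigenvalue of a Hermitian matrix (its eigenvalues are real).\<close>
definition lambda1 :: "complex mat \<Rightarrow> real" where
  "lambda1 M = Max {x :: real. eigenvalue M (complex_of_real x)}"

definition vnorm :: "complex vec \<Rightarrow> real" where
  "vnorm v = sqrt (Re (v \<bullet>c v))"

definition spec_norm :: "complex mat \<Rightarrow> real" where
  "spec_norm M = Sup {vnorm (M *\<^sub>v v) | v. v \<in> carrier_vec (dim_col M) \<and> vnorm v = 1}"

end

theory Submission
  imports "HOL-Analysis.Brouwer_Fixpoint" Defs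
begin

text \<open>With \<open>m = k * c1\<close> the hypotheses give \<open>m^s I + m^(-t) A*A + m^(-p) B*B \<le> Q\<close>. Clamping eigenvalues
  from below at \<open>m\<close> makes \<open>X \<mapsto> (Q - A* max(X,m)^(-t) A - B* max(X,m)^(-p) B)^(1/s)\<close> a bounded
  Lipschitz self-map of all Hermitian matrices with values above \<open>m I\<close>. Brouwer's theorem gives a
  fixed point, at which the clamping is vacuous; it lies below \<open>Q^(1/s)\<close> by the Loewner-Heinz
  inequality. For uniqueness, the Frobenius norm turns scalar bounds into matrix bounds: above \<open>m I\<close>
  the map \<open>X \<mapsto> X^s\<close> expands distances at least by \<open>s m^(s-1)\<close>, while \<open>X \<mapsto> X^(-t)\<close> has Lipschitz
  constant \<open>t m^(-t-1)\<close>.\<close>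

section \<open>Brouwer's theorem in variable dimension\<close>

text \<open>The domination inequality splits \<open>Q\<close> into three shares. The exponents 1/t
  and 1/p in c1 yield A Q^(-1) A* \<le> c1^t I and B Q^(-1) B* \<le> c1^p I, equivalently A*A \<le>
  c1^t Q and B*B \<le> c1^p Q. Scaled by m^(-t) and m^(-p), the two terms take at most k^(-t) Q and
  k^(-p) Q, and the hypothesis on \<open>lambda1\<close> bounds m^s I by the remaining share (1 -
  k^(-t) - k^(-p)) Q. Existence is claimed without a contraction condition, hence a topological
  fixed point theorem. The unclamped map makes no sense at singular matrices, and x^(1/s) with s > 1
  has unbounded slope at 0; clamping both the negative powers and the root removes every domain
  condition, so no convex domain has to be described. The two ends of the interval differ in nature.
  The lower end is a scalar matrix, so it is a statement about eigenvalues. The upper end compares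
  matrices that need not commute and requires operator monotonicity of x^(1/s), available because
  1/s \<le> 1. The factor (1/s) m^(1-s) of the uniqueness condition is the reciprocal of the
  expansion constant of X^s.\<close>

lemma finite_family_convergent_subseq:
  fixes X :: "nat \<Rightarrow> 'a \<Rightarrow> real"
  assumes "finite J" and "\<And>k j. j \<in> J \<Longrightarrow> \<bar>X k j\<bar> \<le> R"
  shows "\<exists>\<phi> x. strict_mono \<phi> \<and> (\<forall>j\<in>J. (\<lambda>k. X (\<phi> k) j) \<longlonglongrightarrow> x j)"
  using assms
proof (induction J rule: finite_induct)
  case empty
  show ?case by (rule exI[of _ id]) (auto simp: strict_mono_def)
next
  case (insert a J)
  have "\<exists>\<phi> x. strict_mono \<phi> \<and> (\<forall>j\<in>J. (\<lambda>k. X (\<phi> k) j) \<longlonglongrightarrow> x j)"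
    by (rule insert.IH) (use insert.prems in auto)
  then obtain \<phi> x where \<phi>: "strict_mono \<phi>" and lim: "\<And>j. j \<in> J \<Longrightarrow> (\<lambda>k. X (\<phi> k) j) \<longlonglongrightarrow> x j"
    by blast
  have "bounded (range (\<lambda>k. X (\<phi> k) a))"
    using insert.prems by (auto simp: bounded_iff)
  then obtain l \<psi> where \<psi>: "strict_mono \<psi>" and l: "((\<lambda>k. X (\<phi> k) a) \<circ> \<psi>) \<longlonglongrightarrow> l"
    using bounded_imp_convergent_subsequence by blast
  have "(\<lambda>k. X ((\<phi> \<circ> \<psi>) k) j) \<longlonglongrightarrow> (x(a := l)) j" if "j \<in> insert a J" for j
  proof (cases "j = a")
    case True
    then show ?thesis using l by (simp add: o_def)
  next
    case False
    then show ?thesis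
      using that LIMSEQ_subseq_LIMSEQ[OF lim \<psi>, of j] by (auto simp: o_def)
  qed
  moreover have "strict_mono (\<phi> \<circ> \<psi>)"
    using \<phi> \<psi> by (rule strict_mono_o)
  ultimately show ?case by blast
qed

lemma choice2: "\<forall>k. \<exists>r s. P k r s \<Longrightarrow> \<exists>r s. \<forall>k. P k (r k) (s k)"
  by metis

text \<open>The index set \<open>J\<close> is a value, so the dimension may vary inside a statement; with the
  type-indexed spaces of the Brouwer theorem of the library it could not.\<close>

theorem brouwer_bounded_coordinatewise:
  fixes F :: "('a \<Rightarrow> real) \<Rightarrow> 'a \<Rightarrow> real"
  assumes fin: "finite J" and R: "R > 0"
    and bnd: "\<And>x j. j \<in> J \<Longrightarrow> \<bar>F x j\<bar> \<le> R"
    and cont: "\<And>X x j. \<lbrakk>\<And>i. i \<in> J \<Longrightarrow> (\<lambda>k. X k i) \<longlonglongrightarrow> x i; j \<in> J\<rbrakk>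
                 \<Longrightarrow> (\<lambda>k. F (X k) j) \<longlonglongrightarrow> F x j"
  shows "\<exists>x. \<forall>j\<in>J. F x j = x j"
proof -
  define N where "N = card J"
  obtain h where h: "bij_betw h {..<N} J"
    using ex_bij_betw_nat_finite[OF fin] by (auto simp: N_def atLeast0LessThan)
  define g where "g = the_inv_into {..<N} h"
  have gh: "g (h i) = i" if "i < N" for i
    using that h by (simp add: g_def bij_betw_def the_inv_into_f_f)
  have gJ: "g j < N \<and> h (g j) = j" if "j \<in> J" for j
    using that h by (metis bij_betw_def f_the_inv_into_f g_def lessThan_iff the_inv_into_into
        order_refl)
  \<comment> \<open>The lattice point \<open>y\<close> of {0..p}^N, rescaled to the cube
    [-R, R]^J.\<close>
  define pt where "pt p y = (\<lambda>j. 2 * R * (real (y (g j)) / real p) - R)" for p :: nat and y :: "nat \<Rightarrow> nat"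
  \<comment> \<open>Kuhn labelling: 0 where \<open>F\<close> pushes coordinate \<open>i\<close> up,
    1 otherwise. The face \<open>y i = 0\<close> is forced to 0 as the combinatorial lemma demands;
    this stays consistent because there \<open>pt\<close> equals \<open>- R\<close>, a lower bound
    of \<open>F\<close>. On the opposite face \<open>pt\<close> equals \<open>R\<close>, so the
    label is 1.\<close>
  define lab where "lab p y i = (if y i = 0 \<or> F (pt p y) (h i) > pt p y (h i) then 0 else 1 :: nat)"
    for p :: nat and y :: "nat \<Rightarrow> nat" and i
  have hJ: "h i \<in> J" if "i < N" for i
    using h that by (auto simp: bij_betw_def)
  have lab0: "F (pt p y) (h i) \<ge> pt p y (h i)" if "lab p y i = 0" "i < N" for p y i
    using that bnd[OF hJ[OF that(2)], of "pt p y"]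
    by (auto simp: lab_def pt_def gh split: if_splits)
  have lab1: "F (pt p y) (h i) \<le> pt p y (h i)" if "lab p y i \<noteq> 0" "i < N" for p y i
    using that by (auto simp: lab_def split: if_splits)
  define near where "near q r \<longleftrightarrow> (\<forall>j<N. q j \<le> r j \<and> r j \<le> q j + 1)" for q r :: "nat \<Rightarrow> nat"
  \<comment> \<open>A cell of the grid of mesh \<open>2 * R / Suc k\<close> in which, for every
    coordinate, both labels occur at corners.\<close>
  define kuhn_cell where "kuhn_cell k q \<longleftrightarrow> (\<forall>i<N. q i < Suc k) \<and>
      (\<forall>i<N. \<exists>r s. near q r \<and> near q s \<and> lab (Suc k) r i = 0 \<and> lab (Suc k) s i \<noteq> 0)" for k q
  have "\<exists>q. kuhn_cell k q" for k
  proof -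
    have c1: "\<forall>x. (\<forall>i<N. x i \<le> Suc k) \<longrightarrow> (\<forall>i<N. lab (Suc k) x i = 0 \<or> lab (Suc k) x i = 1)"
      and c2: "\<forall>x. (\<forall>i<N. x i \<le> Suc k) \<longrightarrow> (\<forall>i<N. x i = 0 \<longrightarrow> lab (Suc k) x i = 0)"
      by (simp_all add: lab_def)
    have c3: "\<forall>x. (\<forall>i<N. x i \<le> Suc k) \<longrightarrow> (\<forall>i<N. x i = Suc k \<longrightarrow> lab (Suc k) x i = 1)"
    proof (intro allI impI)
      fix x i assume "i < N" "x i = Suc k"
      then show "lab (Suc k) x i = 1"
        using bnd[OF hJ, of i "pt (Suc k) x"] by (simp add: lab_def pt_def gh)
    qed
    obtain q where q: "\<forall>i<N. q i < Suc k"
      "\<forall>i<N. \<exists>r s. near q r \<and> near q s \<and> lab (Suc k) r i \<noteq> lab (Suc k) s i"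
      unfolding near_def by (rule kuhn_lemma[OF zero_less_Suc c1 c2 c3])
    have "\<exists>r s. near q r \<and> near q s \<and> lab (Suc k) r i = 0 \<and> lab (Suc k) s i \<noteq> 0" if i: "i < N" for i
    proof -
      obtain r s where rs: "near q r" "near q s" "lab (Suc k) r i \<noteq> lab (Suc k) s i"
        using q(2) i by blast
      show ?thesis
      proof (cases "lab (Suc k) r i = 0")
        case True
        then have "lab (Suc k) s i \<noteq> 0" using rs(3) by simp
        then show ?thesis using rs True by blast
      next
        case False
        then have "lab (Suc k) s i = 0" using rs(3) by (auto simp: lab_def split: if_splits)
        then show ?thesis using rs False by blast
      qed
    qed
    then show ?thesis using q(1) unfolding kuhn_cell_def by blast
  qed
  then obtain q where q: "\<And>k. kuhn_cell k (q k)"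
    by metis
  have q1: "q k i < Suc k" if "i < N" for k i
    using q[of k] that unfolding kuhn_cell_def by blast
  have q2: "\<exists>r s. near (q k) r \<and> near (q k) s \<and> lab (Suc k) r i = 0 \<and> lab (Suc k) s i \<noteq> 0"
    if "i < N" for k i
    using q[of k] that unfolding kuhn_cell_def by blast
  have ptb: "\<bar>pt (Suc k) (q k) j\<bar> \<le> R" if "j \<in> J" for k j
  proof -
    have "real (q k (g j)) / real (Suc k) \<le> 1"
      using q1[of "g j" k] gJ[OF that] by simp
    moreover have "real (q k (g j)) / real (Suc k) \<ge> 0" by simp
    ultimately have "R * (real (q k (g j)) / real (Suc k)) \<le> R * 1"
      "0 \<le> R * (real (q k (g j)) / real (Suc k))"
      using R by (auto intro: mult_left_mono simp del: times_divide_eq_right)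
    then show ?thesis by (simp add: pt_def abs_le_iff del: times_divide_eq_right)
  qed
  obtain \<phi> x where \<phi>: "strict_mono \<phi>"
    and x: "\<And>j. j \<in> J \<Longrightarrow> (\<lambda>k. pt (Suc (\<phi> k)) (q (\<phi> k)) j) \<longlonglongrightarrow> x j"
    using finite_family_convergent_subseq[OF fin, of "\<lambda>k. pt (Suc k) (q k)" R] ptb by blast
  \<comment> \<open>Corners of a cell differ from its base point by at most one mesh width per
    coordinate, so any choice of corners has the same limit as the base points.\<close>
  have lim_near: "(\<lambda>k. pt (Suc (\<phi> k)) (r k) j) \<longlonglongrightarrow> x j"
    if near: "\<And>k. near (q (\<phi> k)) (r k)" and j: "j \<in> J" for r j
  proof -
    have r: "q (\<phi> k) j \<le> r k j \<and> r k j \<le> q (\<phi> k) j + 1" if "j < N" for j k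
      using near[of k] that unfolding near_def by blast
    have b: "\<bar>pt (Suc (\<phi> k)) (r k) j - pt (Suc (\<phi> k)) (q (\<phi> k)) j\<bar> \<le> 2 * R * inverse (real (Suc k))" for k
    proof -
      have "\<bar>pt (Suc (\<phi> k)) (r k) j - pt (Suc (\<phi> k)) (q (\<phi> k)) j\<bar>
          = \<bar>2 * R * ((real (r k (g j)) - real (q (\<phi> k) (g j))) / real (Suc (\<phi> k)))\<bar>"
        by (simp add: pt_def right_diff_distrib diff_divide_distrib)
      also have "\<dots> = 2 * R * ((real (r k (g j)) - real (q (\<phi> k) (g j))) / real (Suc (\<phi> k)))"
        using R r[of "g j" k] gJ[OF j] by (intro abs_of_nonneg) auto
      also have "\<dots> \<le> 2 * R * (1 / real (Suc (\<phi> k)))"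
        using R r[of "g j" k] gJ[OF j] by (intro mult_left_mono divide_right_mono) auto
      also have "\<dots> \<le> 2 * R * inverse (real (Suc k))"
        using R seq_suble[OF \<phi>, of k] by (intro mult_left_mono) (auto simp: field_simps)
      finally show ?thesis .
    qed
    have lim0: "(\<lambda>k. 2 * R * inverse (real (Suc k))) \<longlonglongrightarrow> 0"
      using tendsto_mult[OF tendsto_const LIMSEQ_inverse_real_of_nat, of "2 * R"]
      by (simp only: mult_zero_right)
    have "\<forall>\<^sub>F k in sequentially. norm (pt (Suc (\<phi> k)) (r k) j - pt (Suc (\<phi> k)) (q (\<phi> k)) j)
        \<le> 2 * R * inverse (real (Suc k))"
      using b by (intro always_eventually allI) (simp only: real_norm_def)
    from Lim_null_comparison[OF this lim0]
    have "(\<lambda>k. pt (Suc (\<phi> k)) (r k) j - pt (Suc (\<phi> k)) (q (\<phi> k)) j) \<longlonglongrightarrow> 0" .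
    from tendsto_add[OF this x[OF j]] show ?thesis by simp
  qed
  \<comment> \<open>The corners labelled 0 and those labelled 1 both tend to \<open>x\<close>;
    continuity turns their opposite inequalities into equality.\<close>
  have "F x (h i) = x (h i)" if i: "i < N" for i
  proof -
    have "\<exists>r s. \<forall>k. near (q (\<phi> k)) (r k) \<and> near (q (\<phi> k)) (s k) \<and>
        lab (Suc (\<phi> k)) (r k) i = 0 \<and> lab (Suc (\<phi> k)) (s k) i \<noteq> 0"
      by (intro choice2 allI q2[OF i])
    then obtain r s where r: "\<And>k. near (q (\<phi> k)) (r k)" and s: "\<And>k. near (q (\<phi> k)) (s k)"
      and lr: "\<And>k. lab (Suc (\<phi> k)) (r k) i = 0" and ls: "\<And>k. lab (Suc (\<phi> k)) (s k) i \<noteq> 0"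
      by blast
    note nr = lim_near[OF r] and ns = lim_near[OF s]
    have "x (h i) \<le> F x (h i)"
      by (rule LIMSEQ_le[OF nr[OF hJ[OF i]] cont[OF nr hJ[OF i]]]) (use lab0[OF lr i] in auto)
    moreover have "F x (h i) \<le> x (h i)"
      by (rule LIMSEQ_le[OF cont[OF ns hJ[OF i]] ns[OF hJ[OF i]]]) (use lab1[OF ls i] in auto)
    ultimately show ?thesis by simp
  qed
  then show ?thesis using gJ by metis
qed

section \<open>The spectral theorem\<close>

lemma mat_adjoint_dim [simp]: "dim_row (mat_adjoint A) = dim_col A" "dim_col (mat_adjoint A) = dim_row A"
  by (simp_all add: mat_adjoint_def)

lemma mat_adjoint_carrier [simp]: "A \<in> carrier_mat n m \<Longrightarrow> mat_adjoint A \<in> carrier_mat m n"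
  by (intro carrier_matI) simp_all

lemma mat_adjoint_index [simp]:
  fixes A :: "complex mat"
  assumes "i < dim_col A" "j < dim_row A"
  shows "mat_adjoint A $$ (i, j) = cnj (A $$ (j, i))"
  using assms by (simp add: mat_adjoint_def mat_of_rows_index)

lemma mat_adjoint_adjoint [simp]: "mat_adjoint (mat_adjoint A) = (A :: complex mat)"
  by (rule eq_matI) auto

lemma mat_adjoint_mult:
  fixes A B :: "complex mat"
  assumes "A \<in> carrier_mat n m" "B \<in> carrier_mat m l"
  shows "mat_adjoint (A * B) = mat_adjoint B * mat_adjoint A"
  using assms by (intro eq_matI) (auto simp: scalar_prod_def mult.commute)

lemma mat_adjoint_minus:
  fixes A B :: "complex mat"
  assumes "A \<in> carrier_mat n m" "B \<in> carrier_mat n m"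
  shows "mat_adjoint (A - B) = mat_adjoint A - mat_adjoint B"
  using assms by (intro eq_matI) auto

lemma mat_adjoint_smult_of_real:
  "mat_adjoint (complex_of_real c \<cdot>\<^sub>m A) = complex_of_real c \<cdot>\<^sub>m mat_adjoint A"
  by (intro eq_matI) auto

lemma mat_adjoint_one [simp]: "mat_adjoint (1\<^sub>m n :: complex mat) = 1\<^sub>m n"
  by (intro eq_matI) auto

lemma adjoint_mat_diag_of_real [simp]:
  "mat_adjoint (mat_diag n (\<lambda>i. complex_of_real (d i))) = mat_diag n (\<lambda>i. complex_of_real (d i))"
  by (intro eq_matI) (auto simp: mat_diag_def)

section \<open>The sesquilinear form and unitary matrices\<close>

lemma cscalar_prod_sum:
  fixes x y :: "complex vec"
  assumes "x \<in> carrier_vec n" "y \<in> carrier_vec n"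
  shows "x \<bullet>c y = (\<Sum>i<n. x $ i * cnj (y $ i))"
  using assms by (auto simp: scalar_prod_def atLeast0LessThan intro!: sum.cong)

lemma cscalar_prod_adjoint:
  fixes x y :: "complex vec"
  assumes "A \<in> carrier_mat n m" "x \<in> carrier_vec m" "y \<in> carrier_vec n"
  shows "(A *\<^sub>v x) \<bullet>c y = x \<bullet>c (mat_adjoint A *\<^sub>v y)"
proof -
  have "(A *\<^sub>v x) \<bullet>c y = (\<Sum>i<n. \<Sum>j<m. A $$ (i, j) * x $ j * cnj (y $ i))"
    using assms by (subst cscalar_prod_sum[of _ n])
      (auto simp: scalar_prod_def atLeast0LessThan sum_distrib_right intro!: sum.cong)
  also have "\<dots> = (\<Sum>j<m. \<Sum>i<n. A $$ (i, j) * x $ j * cnj (y $ i))"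
    by (rule sum.swap)
  also have "\<dots> = (\<Sum>j<m. x $ j * cnj ((mat_adjoint A *\<^sub>v y) $ j))"
  proof (rule sum.cong[OF refl])
    fix j assume j: "j \<in> {..<m}"
    have "cnj ((mat_adjoint A *\<^sub>v y) $ j) = (\<Sum>i<n. A $$ (i, j) * cnj (y $ i))"
      using assms j by (simp add: scalar_prod_def atLeast0LessThan)
    then show "(\<Sum>i<n. A $$ (i, j) * x $ j * cnj (y $ i)) = x $ j * cnj ((mat_adjoint A *\<^sub>v y) $ j)"
      by (simp add: sum_distrib_left mult.assoc mult.left_commute)
  qed
  also have "\<dots> = x \<bullet>c (mat_adjoint A *\<^sub>v y)"
    using assms by (subst cscalar_prod_sum[of _ m]) (auto intro!: mult_mat_vec_carrier[of _ m n])
  finally show ?thesis .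
qed

lemma square_mult_carrier [simp]:
  "A \<in> carrier_mat n n \<Longrightarrow> B \<in> carrier_mat n n \<Longrightarrow> A * B \<in> carrier_mat n n"
  by (rule mult_carrier_mat)

lemma square_mult_vec_carrier [simp]:
  "A \<in> carrier_mat n n \<Longrightarrow> v \<in> carrier_vec n \<Longrightarrow> A *\<^sub>v v \<in> carrier_vec n"
  by (rule mult_mat_vec_carrier)

lemma unitary_carrier: "unitary_mat n U \<Longrightarrow> U \<in> carrier_mat n n"
  by (simp add: unitary_mat_def)

lemma unitary_adjoint_mult: "unitary_mat n U \<Longrightarrow> mat_adjoint U * U = 1\<^sub>m n"
  by (simp add: unitary_mat_def)

lemma unitary_mult_adjoint: "unitary_mat n U \<Longrightarrow> U * mat_adjoint U = 1\<^sub>m n"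
  unfolding unitary_mat_def by (rule mat_mult_left_right_inverse[of "mat_adjoint U" n U]) auto

lemma unitary_adjoint: "unitary_mat n U \<Longrightarrow> unitary_mat n (mat_adjoint U)"
  using unitary_mult_adjoint[of n U] by (auto simp: unitary_mat_def)

lemma unitary_mult:
  assumes "unitary_mat n U" "unitary_mat n V"
  shows "unitary_mat n (U * V)"
proof -
  have c: "U \<in> carrier_mat n n" "V \<in> carrier_mat n n"
    using assms by (auto simp: unitary_mat_def)
  have "mat_adjoint (U * V) * (U * V) = mat_adjoint V * (mat_adjoint U * U) * V"
    using c by (simp add: mat_adjoint_mult[of _ n n _ n] assoc_mult_mat[of _ n n _ n _ n])
  then show ?thesis
    using assms c by (simp add: unitary_mat_def)
qed

text \<open>Gram-Schmidt on a basis that starts with \<open>v\<close> keeps \<open>v\<close> in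
  first place; normalising the orthogonal vectors gives the columns, and \<open>c\<close> is the
  normalising factor of \<open>v\<close>. This prepares the deflation step of the spectral
  theorem.\<close>

lemma exists_unitary_first_col:
  fixes v :: "complex vec"
  assumes v: "v \<in> carrier_vec n" "v \<noteq> 0\<^sub>v n"
  shows "\<exists>W c. unitary_mat n W \<and> col W 0 = c \<cdot>\<^sub>v v"
proof -
  interpret cof_vec_space n "TYPE(complex)" .
  define b where "b = basis_completion v"
  define ws where "ws = gram_schmidt n b"
  have n: "n \<noteq> 0" using v by (auto intro: eq_vecI)
  from basis_completion[OF v, folded b_def]
  have dist: "distinct b" and indep: "\<not> lin_dep (set b)" and b: "set b \<subseteq> carrier_vec n"
    and hd: "hd b = v" and len: "length b = n" by auto
  from hd len n obtain vs where bv: "b = v # vs" by (cases b) auto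
  from gram_schmidt_result[OF b dist indep refl, folded ws_def]
  have ws: "set ws \<subseteq> carrier_vec n" "corthogonal ws" "length ws = n"
    by (auto simp: len)
  from gram_schmidt_hd[OF v(1), of vs, folded bv] have hdws: "hd ws = v" unfolding ws_def .
  define c where "c i = complex_of_real (1 / sqrt (Re (ws ! i \<bullet>c ws ! i)))" for i
  define W where "W = mat_of_cols n (map (\<lambda>i. c i \<cdot>\<^sub>v ws ! i) [0..<n])"
  have wsi: "ws ! i \<in> carrier_vec n" if "i < n" for i using ws that by auto
  have W: "W \<in> carrier_mat n n"
    using mat_of_cols_carrier(1)[of n "map (\<lambda>i. c i \<cdot>\<^sub>v ws ! i) [0..<n]"] by (simp add: W_def)
  have colW: "col W i = c i \<cdot>\<^sub>v ws ! i" if "i < n" for i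
    using that wsi[OF that] by (simp add: W_def)
  have pos: "ws ! i \<bullet>c ws ! i = of_real (Re (ws ! i \<bullet>c ws ! i)) \<and> Re (ws ! i \<bullet>c ws ! i) > 0" if "i < n" for i
  proof -
    have "ws ! i \<bullet>c ws ! i \<noteq> 0"
      using corthogonalD[OF ws(2), of i i] ws(3) that by auto
    moreover have "ws ! i \<bullet>c ws ! i \<ge> 0" by (rule conjugate_square_ge_0_vec)
    ultimately show ?thesis by (auto simp: less_eq_complex_def complex_eq_iff)
  qed
  have "mat_adjoint W * W = 1\<^sub>m n"
  proof (rule eq_matI)
    fix i j assume ij: "i < dim_row (1\<^sub>m n :: complex mat)" "j < dim_col (1\<^sub>m n :: complex mat)"
    then have "(mat_adjoint W * W) $$ (i, j) = col W j \<bullet>c col W i"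
      using W by (auto simp: scalar_prod_def mult.commute intro!: sum.cong)
    also have "\<dots> = c j * c i * (ws ! j \<bullet>c ws ! i)"
      using ij wsi[of i] wsi[of j] by (simp add: colW conjugate_smult_vec c_def)
    also have "\<dots> = (if i = j then 1 else 0)"
    proof (cases "i = j")
      case True
      define r where "r = Re (ws ! i \<bullet>c ws ! i)"
      have r: "r > 0" "ws ! i \<bullet>c ws ! i = of_real r"
        using pos[of i] ij by (auto simp: r_def)
      have "c i = of_real (1 / sqrt r)" by (simp add: c_def r_def)
      then have "c i * c i * (ws ! i \<bullet>c ws ! i) = of_real ((1 / sqrt r) * (1 / sqrt r) * r)"
        unfolding r(2) by (simp only: of_real_mult)
      also have "(1 / sqrt r) * (1 / sqrt r) * r = r / (sqrt r * sqrt r)" by simp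
      also have "\<dots> = 1" using r(1) by (simp only: real_sqrt_mult_self abs_of_pos) simp
      finally show ?thesis using True by simp
    next
      case False
      then have "ws ! j \<bullet>c ws ! i = 0" using corthogonalD[OF ws(2), of j i] ws(3) ij by simp
      then show ?thesis using False by simp
    qed
    finally show "(mat_adjoint W * W) $$ (i, j) = 1\<^sub>m n $$ (i, j)" using ij by simp
  qed (use W in auto)
  moreover have "ws ! 0 = v" using hdws ws(3) n by (cases ws) auto
  ultimately show ?thesis
    using W colW[of 0] n by (auto simp: unitary_mat_def)
qed

lemma exists_eigenvector:
  fixes A :: "complex mat"
  assumes A: "A \<in> carrier_mat n n" and n: "n \<noteq> 0"
  shows "\<exists>v e. v \<in> carrier_vec n \<and> v \<noteq> 0\<^sub>v n \<and> A *\<^sub>v v = e \<cdot>\<^sub>v v"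
proof -
  have "degree (char_poly A) = n" using degree_monic_char_poly[OF A] by simp
  then have "\<not> constant (poly (char_poly A))" using n by (simp add: constant_degree)
  then obtain e where "poly (char_poly A) e = 0" using fundamental_theorem_of_algebra by blast
  then have "eigenvalue A e" by (simp add: eigenvalue_root_char_poly[OF A])
  then show ?thesis using A by (auto simp: eigenvalue_def eigenvector_def)
qed

text \<open>Common currency of the proof: \<open>d\<close> lists the eigenvalues with multiplicity,
  and only its values below \<open>n\<close> matter. With \<open>U\<close> fixed, matrix functions
  become arithmetic on \<open>d\<close>.\<close>

definition diagonalizes :: "nat \<Rightarrow> complex mat \<Rightarrow> (nat \<Rightarrow> real) \<Rightarrow> complex mat \<Rightarrow> bool" where
  "diagonalizes n U d X \<longleftrightarrow> unitary_mat n U \<and>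
     X = U * mat_diag n (\<lambda>i. complex_of_real (d i)) * mat_adjoint U"

text \<open>Deflation: in an orthonormal basis whose first vector is an eigenvector, the first
  column is a multiple of the first unit vector, hence by symmetry so is the first row. What remains
  is a Hermitian block of size \<open>m\<close>.\<close>

lemma hermitian_spectral:
  assumes "hermitian_mat n H"
  shows "\<exists>U d. diagonalizes n U d H"
  using assms
proof (induction n arbitrary: H)
  case 0
  then have "diagonalizes 0 (1\<^sub>m 0) (\<lambda>_. 0) H"
    by (auto simp: diagonalizes_def unitary_mat_def hermitian_mat_def intro!: eq_matI)
  then show ?case by blast
next
  case (Suc m)
  let ?n = "Suc m"
  have H: "H \<in> carrier_mat ?n ?n" and Hadj: "mat_adjoint H = H"
    using Suc.prems by (auto simp: hermitian_mat_def)
  obtain v e where v: "v \<in> carrier_vec ?n" "v \<noteq> 0\<^sub>v ?n" and ev: "H *\<^sub>v v = e \<cdot>\<^sub>v v"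
    using exists_eigenvector[OF H] by auto
  obtain W c where W: "unitary_mat ?n W" and W0: "col W 0 = c \<cdot>\<^sub>v v"
    using exists_unitary_first_col[OF v] by blast
  note Wc = unitary_carrier[OF W]
  define H' where "H' = mat_adjoint W * H * W"
  have H': "H' \<in> carrier_mat ?n ?n" using Wc H by (simp add: H'_def)
  have H'adj: "mat_adjoint H' = H'"
    using Wc H Hadj by (simp add: H'_def mat_adjoint_mult[of _ ?n ?n _ ?n] assoc_mult_mat[of _ ?n ?n _ ?n _ ?n])
  have "col H' 0 = mat_adjoint W *\<^sub>v (H *\<^sub>v col W 0)"
    using Wc H col_mult2[of "mat_adjoint W" ?n ?n "H * W" ?n 0] col_mult2[of H ?n ?n W ?n 0]
    by (simp only: H'_def assoc_mult_mat[of _ ?n ?n _ ?n _ ?n] mat_adjoint_carrier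
        square_mult_carrier zero_less_Suc)
  also have "H *\<^sub>v col W 0 = e \<cdot>\<^sub>v col W 0"
    using H v ev by (simp add: W0 mult_mat_vec smult_smult_assoc mult.commute)
  also have "mat_adjoint W *\<^sub>v (e \<cdot>\<^sub>v col W 0) = e \<cdot>\<^sub>v (mat_adjoint W *\<^sub>v col W 0)"
    using Wc by (intro mult_mat_vec[of _ ?n ?n]) (auto intro!: carrier_vecI)
  also have "mat_adjoint W *\<^sub>v col W 0 = col (mat_adjoint W * W) 0"
    using Wc by (simp only: col_mult2[of _ ?n ?n _ ?n] mat_adjoint_carrier zero_less_Suc)
  also have "\<dots> = unit_vec ?n 0"
    by (simp add: unitary_adjoint_mult[OF W])
  finally have colH': "col H' 0 = e \<cdot>\<^sub>v unit_vec ?n 0" .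
  have H'0: "H' $$ (i, 0) = (if i = 0 then e else 0)" if "i < ?n" for i
    using arg_cong[OF colH', of "\<lambda>x. x $ i"] that H' by auto
  have H'sym: "H' $$ (i, j) = cnj (H' $$ (j, i))" if "i < ?n" "j < ?n" for i j
    using arg_cong[OF H'adj, of "\<lambda>x. x $$ (i, j)"] that H' by auto
  \<comment> \<open>The eigenvalue is a diagonal entry of a Hermitian matrix, hence real.\<close>
  have e: "e = of_real (Re e)"
    using H'sym[of 0 0] by (simp add: H'0 complex_eq_iff)
  define M where "M = mat m m (\<lambda>(i, j). H' $$ (Suc i, Suc j))"
  have "mat_adjoint M = M"
  proof (rule eq_matI)
    fix i j assume "i < dim_row M" "j < dim_col M"
    then show "mat_adjoint M $$ (i, j) = M $$ (i, j)"
      using H'sym[of "Suc i" "Suc j"] by (simp add: M_def)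
  qed (simp_all add: M_def)
  then have "hermitian_mat m M" by (simp add: hermitian_mat_def M_def)
  from Suc.IH[OF this] obtain U d where U: "unitary_mat m U"
    and M: "M = U * mat_diag m (\<lambda>i. complex_of_real (d i)) * mat_adjoint U"
    unfolding diagonalizes_def by blast
  note Uc = unitary_carrier[OF U]
  have Mc: "M \<in> carrier_mat m m" by (simp add: M_def)
  \<comment> \<open>Block diagonal embedding. It respects products, adjoints and the identity, so a
    diagonalization of \<open>M\<close> lifts to one of \<open>H'\<close>.\<close>
  define blk where "blk = (\<lambda>a (B :: complex mat). four_block_mat (mat 1 1 (\<lambda>_. a)) (0\<^sub>m 1 m) (0\<^sub>m m 1) B)"
  have blk_c: "blk a B \<in> carrier_mat ?n ?n" if "B \<in> carrier_mat m m" for a B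
    using that by (auto simp: blk_def)
  have blk_mult: "blk a B * blk a' B' = blk (a * a') (B * B')"
    if "B \<in> carrier_mat m m" "B' \<in> carrier_mat m m" for a a' B B'
  proof -
    have "mat 1 1 (\<lambda>_. a) * mat 1 1 (\<lambda>_. a') = mat 1 1 (\<lambda>_. a * a')"
      by (intro eq_matI) (auto simp: scalar_prod_def)
    then show ?thesis
      unfolding blk_def using that
      by (subst mult_four_block_mat[of _ 1 1 _ m _ m _ _ 1 _ m])
        (auto simp: left_add_zero_mat[of _ m m] intro!: cong_four_block_mat)
  qed
  have blk_adj: "mat_adjoint (blk a B) = blk (cnj a) (mat_adjoint B)" if "B \<in> carrier_mat m m" for a B
    using that by (intro eq_matI) (auto simp: blk_def)
  have blk_one: "blk 1 (1\<^sub>m m) = 1\<^sub>m ?n"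
    by (intro eq_matI) (auto simp: blk_def)
  have H'blk: "H' = blk e M"
  proof (rule eq_matI)
    fix i j assume "i < dim_row (blk e M)" "j < dim_col (blk e M)"
    then have ij: "i < ?n" "j < ?n" by (auto simp: blk_def M_def)
    then show "H' $$ (i, j) = blk e M $$ (i, j)"
      using H'0[of i] H'0[of j] H'sym[of i j]
      by (cases i; cases j) (auto simp: blk_def M_def)
  qed (use H' in \<open>auto simp: blk_def M_def\<close>)
  define d' where "d' = (\<lambda>i. case i of 0 \<Rightarrow> Re e | Suc j \<Rightarrow> d j)"
  have diag: "blk e (mat_diag m (\<lambda>i. complex_of_real (d i))) = mat_diag ?n (\<lambda>i. complex_of_real (d' i))"
    using e by (intro eq_matI) (auto simp: blk_def mat_diag_def d'_def split: nat.splits)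
  have uB: "unitary_mat ?n (blk 1 U)"
    using Uc by (simp add: unitary_mat_def blk_adj blk_mult blk_one unitary_adjoint_mult[OF U] blk_c)
  have "H = W * H' * mat_adjoint W"
  proof -
    have "W * H' * mat_adjoint W = (W * mat_adjoint W) * H * (W * mat_adjoint W)"
      using Wc H by (simp add: H'_def assoc_mult_mat[of _ ?n ?n _ ?n _ ?n])
    then show ?thesis using H by (simp add: unitary_mult_adjoint[OF W])
  qed
  also have "H' = blk 1 U * mat_diag ?n (\<lambda>i. complex_of_real (d' i)) * mat_adjoint (blk 1 U)"
    unfolding H'blk diag[symmetric] M using Uc by (simp add: blk_adj blk_mult)
  also have "W * (blk 1 U * mat_diag ?n (\<lambda>i. complex_of_real (d' i)) * mat_adjoint (blk 1 U)) * mat_adjoint W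
      = (W * blk 1 U) * mat_diag ?n (\<lambda>i. complex_of_real (d' i)) * mat_adjoint (W * blk 1 U)"
    using Wc blk_c[OF Uc, of 1]
    by (simp add: mat_adjoint_mult[of _ ?n ?n _ ?n] assoc_mult_mat[of _ ?n ?n _ ?n _ ?n])
  finally have "diagonalizes ?n (W * blk 1 U) d' H"
    using unitary_mult[OF W uB] by (simp add: diagonalizes_def)
  then show ?case by blast
qed

section \<open>Frobenius norm and functional calculus\<close>

lemma mat_col_carrier: "M \<in> carrier_mat n m \<Longrightarrow> col M j \<in> carrier_vec n"
  by (intro carrier_vecI) simp

lemma vnorm_sq:
  assumes "v \<in> carrier_vec n"
  shows "(vnorm v)\<^sup>2 = (\<Sum>i<n. (cmod (v $ i))\<^sup>2)"
proof -
  have "v \<bullet>c v = (\<Sum>i<n. complex_of_real ((cmod (v $ i))\<^sup>2))"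
    using assms by (subst cscalar_prod_sum[of _ n]) (simp_all add: complex_norm_square del: of_real_power)
  then have "Re (v \<bullet>c v) = (\<Sum>i<n. (cmod (v $ i))\<^sup>2)"
    by (simp del: of_real_power)
  then show ?thesis by (simp add: vnorm_def sum_nonneg)
qed

lemma cscalar_prod_self:
  assumes "v \<in> carrier_vec n"
  shows "v \<bullet>c v = complex_of_real ((vnorm v)\<^sup>2)"
  using assms by (subst cscalar_prod_sum[of _ n])
    (simp_all add: complex_norm_square vnorm_sq del: of_real_power)

lemma vnorm_nonneg [simp]: "0 \<le> vnorm v"
proof -
  have "Re (v \<bullet>c v) \<ge> 0"
    using cscalar_prod_self[OF carrier_vec_dim_vec, of v] by simp
  then show ?thesis by (simp add: vnorm_def)
qed

lemma vnorm_eq_0_iff: "v \<in> carrier_vec n \<Longrightarrow> vnorm v = 0 \<longleftrightarrow> v = 0\<^sub>v n"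
  using cscalar_prod_self[of v n] conjugate_square_eq_0_vec[of v n] by simp

lemma vnorm_smult:
  assumes "v \<in> carrier_vec n"
  shows "vnorm (c \<cdot>\<^sub>v v) = cmod c * vnorm v"
proof -
  have "(vnorm (c \<cdot>\<^sub>v v))\<^sup>2 = (cmod c * vnorm v)\<^sup>2"
    using assms by (simp add: vnorm_sq[of _ n] norm_mult power_mult_distrib sum_distrib_left)
  then show ?thesis by (simp add: power2_eq_iff_nonneg)
qed

lemma cscalar_prod_Cauchy_Schwarz:
  fixes x y :: "complex vec"
  assumes "x \<in> carrier_vec n" "y \<in> carrier_vec n"
  shows "cmod (x \<bullet>c y) \<le> vnorm x * vnorm y"
proof -
  have "cmod (x \<bullet>c y) \<le> (\<Sum>i<n. cmod (x $ i) * cmod (y $ i))"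
    using assms by (subst cscalar_prod_sum[of _ n])
      (auto intro!: order_trans[OF norm_sum] simp: norm_mult)
  also have "\<dots> \<le> vnorm x * vnorm y"
  proof (rule power2_le_imp_le)
    show "(\<Sum>i<n. cmod (x $ i) * cmod (y $ i))\<^sup>2 \<le> (vnorm x * vnorm y)\<^sup>2"
      using Cauchy_Schwarz_ineq_sum[of "\<lambda>i. cmod (x $ i)" "\<lambda>i. cmod (y $ i)" "{..<n}"] assms
      by (simp add: power_mult_distrib vnorm_sq[of _ n])
  qed simp
  finally show ?thesis .
qed

lemma unitary_vnorm:
  assumes U: "unitary_mat n U" and v: "v \<in> carrier_vec n"
  shows "vnorm (U *\<^sub>v v) = vnorm v"
proof -
  note Uc = unitary_carrier[OF U]
  have "(U *\<^sub>v v) \<bullet>c (U *\<^sub>v v) = v \<bullet>c ((mat_adjoint U * U) *\<^sub>v v)"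
    using Uc v by (simp add: cscalar_prod_adjoint[of U n n] assoc_mult_mat_vec[of _ n n _ n])
  then show ?thesis using U v by (simp add: vnorm_def unitary_adjoint_mult)
qed

text \<open>The squared Frobenius norm, kept without the root because the comparisons are made term
  by term in sums of squares.\<close>

definition frob_sq :: "complex mat \<Rightarrow> real" where
  "frob_sq M = (\<Sum>i<dim_row M. \<Sum>j<dim_col M. (cmod (M $$ (i, j)))\<^sup>2)"

lemma frob_sq_nonneg [simp]: "0 \<le> frob_sq M"
  by (simp add: frob_sq_def sum_nonneg)

text \<open>Left multiplication acts on each column separately, so this form carries vector norm
  estimates over to matrices.\<close>

lemma frob_sq_cols:
  assumes "M \<in> carrier_mat n m"
  shows "frob_sq M = (\<Sum>j<m. (vnorm (col M j))\<^sup>2)"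
proof -
  have "frob_sq M = (\<Sum>j<m. \<Sum>i<n. (cmod (M $$ (i, j)))\<^sup>2)"
    using assms unfolding frob_sq_def by (simp add: sum.swap[of _ "{..<m}"])
  also have "\<dots> = (\<Sum>j<m. (vnorm (col M j))\<^sup>2)"
    using assms by (intro sum.cong refl) (simp add: vnorm_sq[of _ n] mat_col_carrier[of _ n m])
  finally show ?thesis .
qed

lemma frob_sq_adjoint: "frob_sq (mat_adjoint M) = frob_sq M"
  unfolding frob_sq_def by (subst sum.swap) simp

lemma frob_sq_entry_le:
  assumes "i < dim_row M" "j < dim_col M"
  shows "(cmod (M $$ (i, j)))\<^sup>2 \<le> frob_sq M"
proof -
  have "(cmod (M $$ (i, j)))\<^sup>2 \<le> (\<Sum>j<dim_col M. (cmod (M $$ (i, j)))\<^sup>2)"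
    using assms by (intro member_le_sum) auto
  also have "\<dots> \<le> frob_sq M"
    unfolding frob_sq_def using assms
    by (intro member_le_sum[of i _ "\<lambda>i. \<Sum>j<dim_col M. (cmod (M $$ (i, j)))\<^sup>2"]) (auto intro: sum_nonneg)
  finally show ?thesis .
qed

lemma frob_sq_minus_eq_0:
  assumes "M \<in> carrier_mat n m" "N \<in> carrier_mat n m" "frob_sq (M - N) = 0"
  shows "M = N"
proof (rule eq_matI)
  fix i j assume "i < dim_row N" "j < dim_col N"
  then show "M $$ (i, j) = N $$ (i, j)"
    using frob_sq_entry_le[of i "M - N" j] assms by simp
qed (use assms in auto)

lemma frob_sq_unitary_left:
  assumes U: "unitary_mat n U" and M: "M \<in> carrier_mat n n"
  shows "frob_sq (U * M) = frob_sq M"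
proof -
  note Uc = unitary_carrier[OF U]
  have "vnorm (col (U * M) j) = vnorm (col M j)" if "j < n" for j
    using unitary_vnorm[OF U, of "col M j"] col_mult2[OF Uc M that] M by (simp add: mat_col_carrier[of _ n n])
  then show ?thesis
    using Uc M by (simp add: frob_sq_cols[of _ n n])
qed

lemma frob_sq_unitary_right:
  assumes U: "unitary_mat n U" and M: "M \<in> carrier_mat n n"
  shows "frob_sq (M * U) = frob_sq M"
proof -
  note Uc = unitary_carrier[OF U]
  have "frob_sq (M * U) = frob_sq (mat_adjoint U * mat_adjoint M)"
    using M Uc by (metis frob_sq_adjoint mat_adjoint_mult)
  also have "\<dots> = frob_sq M"
    using M by (simp add: frob_sq_unitary_left[OF unitary_adjoint[OF U]] frob_sq_adjoint)
  finally show ?thesis .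
qed

lemma diagonalizes_carrier: "diagonalizes n U d X \<Longrightarrow> X \<in> carrier_mat n n"
  by (auto simp: diagonalizes_def dest!: unitary_carrier)

text \<open>Conjugating \<open>X - Y\<close> by the two eigenbases gives the entries \<open>(d i - e j) * W i j\<close>, so in the
  Frobenius norm scalar Lipschitz bounds pass to matrix functions with the same constant.\<close>

lemma frob_sq_diff_diagonalized:
  assumes X: "diagonalizes n U d X" and Y: "diagonalizes n V e Y"
  shows "frob_sq (X - Y)
    = (\<Sum>i<n. \<Sum>j<n. (d i - e j)\<^sup>2 * (cmod ((mat_adjoint U * V) $$ (i, j)))\<^sup>2)"
proof -
  have U: "unitary_mat n U" and V: "unitary_mat n V" using X Y by (auto simp: diagonalizes_def)
  note Uc = unitary_carrier[OF U] and Vc = unitary_carrier[OF V]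
  note Xc = diagonalizes_carrier[OF X] and Yc = diagonalizes_carrier[OF Y]
  define D where "D = mat_diag n (\<lambda>i. complex_of_real (d i))"
  define E where "E = mat_diag n (\<lambda>i. complex_of_real (e i))"
  define W where "W = mat_adjoint U * V"
  have c [simp]: "D \<in> carrier_mat n n" "E \<in> carrier_mat n n" "W \<in> carrier_mat n n"
    using Uc Vc by (auto simp: D_def E_def W_def)
  have "mat_adjoint U * X * V = (mat_adjoint U * U) * D * W"
    using X Uc Vc by (simp add: diagonalizes_def D_def W_def assoc_mult_mat[of _ n n _ n _ n])
  then have 1: "mat_adjoint U * X * V = D * W"
    by (simp add: unitary_adjoint_mult[OF U] left_mult_one_mat[of _ n n])
  have "mat_adjoint U * Y * V = W * E * (mat_adjoint V * V)"
    using Y Uc Vc by (simp add: diagonalizes_def E_def W_def assoc_mult_mat[of _ n n _ n _ n])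
  then have 2: "mat_adjoint U * Y * V = W * E"
    by (simp add: unitary_adjoint_mult[OF V] right_mult_one_mat[of _ n n])
  have "mat_adjoint U * (X - Y) * V = D * W - W * E"
    using Uc Vc Xc Yc by (simp add: mult_minus_distrib_mat[of _ n n] minus_mult_distrib_mat[of _ n n] 1 2)
  moreover have "frob_sq (mat_adjoint U * (X - Y) * V) = frob_sq (X - Y)"
    using Uc minus_carrier_mat[OF Yc, of X]
    by (simp add: frob_sq_unitary_right[OF V] frob_sq_unitary_left[OF unitary_adjoint[OF U]])
  ultimately have "frob_sq (X - Y) = frob_sq (D * W - W * E)" by simp
  also have "\<dots> = (\<Sum>i<n. \<Sum>j<n. (cmod ((D * W - W * E) $$ (i, j)))\<^sup>2)"
    by (simp add: frob_sq_def D_def E_def mat_diag_mult_left[of _ n n] mat_diag_mult_right[of _ n n])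
  also have "\<dots> = (\<Sum>i<n. \<Sum>j<n. (d i - e j)\<^sup>2 * (cmod (W $$ (i, j)))\<^sup>2)"
  proof (intro sum.cong refl)
    fix i j assume "i \<in> {..<n}" "j \<in> {..<n}"
    then have "(D * W - W * E) $$ (i, j) = of_real (d i - e j) * W $$ (i, j)"
      by (simp add: D_def E_def mat_diag_mult_left[of _ n n] mat_diag_mult_right[of _ n n] algebra_simps)
    then show "(cmod ((D * W - W * E) $$ (i, j)))\<^sup>2 = (d i - e j)\<^sup>2 * (cmod (W $$ (i, j)))\<^sup>2"
      by (simp add: norm_mult power_mult_distrib del: of_real_diff)
  qed
  finally show ?thesis unfolding W_def .
qed

text \<open>Both squared distances are sums with the same weights \<open>(cmod (W i j))^2\<close>,
  \<open>W\<close> being the change of eigenbasis, so they compare termwise. The pairs may be used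
  in either role: with the functions as images this is a Lipschitz bound, with the roles exchanged
  an expansion bound.\<close>

lemma frob_sq_diff_mono:
  assumes XY: "diagonalizes n U d X" "diagonalizes n V e Y"
    and XY': "diagonalizes n U d' X'" "diagonalizes n V e' Y'"
    and le: "\<And>i j. i < n \<Longrightarrow> j < n \<Longrightarrow> \<bar>d' i - e' j\<bar> \<le> L * \<bar>d i - e j\<bar>"
  shows "frob_sq (X' - Y') \<le> L\<^sup>2 * frob_sq (X - Y)"
proof -
  have "(d' i - e' j)\<^sup>2 \<le> L\<^sup>2 * (d i - e j)\<^sup>2" if "i < n" "j < n" for i j
  proof -
    have "\<bar>d' i - e' j\<bar>\<^sup>2 \<le> (L * \<bar>d i - e j\<bar>)\<^sup>2"
      using le[OF that] by (intro power_mono) auto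
    then show ?thesis by (simp add: power_mult_distrib)
  qed
  then show ?thesis
    unfolding frob_sq_diff_diagonalized[OF XY] frob_sq_diff_diagonalized[OF XY'] sum_distrib_left
    by (intro sum_mono) (auto simp: mult.assoc[symmetric] intro!: mult_right_mono)
qed

text \<open>The functional calculus is independent of the eigenbasis: \<open>X - X = 0\<close>
  forces \<open>d i = e j\<close> wherever the weight at \<open>(i, j)\<close> is nonzero, and then
  \<open>f (d i) = f (e j)\<close> there as well.\<close>

lemma diagonalized_function_unique:
  assumes XY: "diagonalizes n U d X" "diagonalizes n V e X"
    and Z: "diagonalizes n U (\<lambda>i. f (d i)) Z" "diagonalizes n V (\<lambda>i. f (e i)) Z'"
  shows "Z = Z'"
proof -
  have Xc: "X \<in> carrier_mat n n" using XY(1) by (rule diagonalizes_carrier)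
  have "frob_sq (X - X) = 0"
    using Xc by (simp add: frob_sq_def)
  then have 0: "(\<Sum>i<n. \<Sum>j<n. (d i - e j)\<^sup>2 * (cmod ((mat_adjoint U * V) $$ (i, j)))\<^sup>2) = 0"
    unfolding frob_sq_diff_diagonalized[OF XY] .
  have "(d i - e j)\<^sup>2 * (cmod ((mat_adjoint U * V) $$ (i, j)))\<^sup>2 = 0" if "i < n" "j < n" for i j
    using 0 that by (simp add: sum_nonneg_eq_0_iff sum_nonneg)
  then have "(f (d i) - f (e j))\<^sup>2 * (cmod ((mat_adjoint U * V) $$ (i, j)))\<^sup>2 = 0" if "i < n" "j < n" for i j
    using that by fastforce
  then have "frob_sq (Z - Z') = 0"
    unfolding frob_sq_diff_diagonalized[OF Z] by (intro sum.neutral ballI) auto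
  then show ?thesis
    using frob_sq_minus_eq_0 diagonalizes_carrier[OF Z(1)] diagonalizes_carrier[OF Z(2)] by blast
qed

section \<open>Functional calculus: scalar functions, real powers, inverses\<close>

lemma diagonalizes_exists: "unitary_mat n U \<Longrightarrow> \<exists>Z. diagonalizes n U d Z"
  by (simp add: diagonalizes_def)

text \<open>Applies to any real function and any Hermitian matrix, whereas \<open>mpow\<close>
  presupposes positive eigenvalues. This generality is what allows clamping.\<close>

definition matfun :: "(real \<Rightarrow> real) \<Rightarrow> complex mat \<Rightarrow> complex mat" where
  "matfun f X = (SOME Z. \<exists>U d. diagonalizes (dim_row X) U d X \<and> diagonalizes (dim_row X) U (\<lambda>i. f (d i)) Z)"

lemma diagonalizes_matfun:
  assumes X: "diagonalizes n U d X"
  shows "diagonalizes n U (\<lambda>i. f (d i)) (matfun f X)"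
proof -
  have n: "dim_row X = n" using diagonalizes_carrier[OF X] by simp
  obtain Z where Z: "diagonalizes n U (\<lambda>i. f (d i)) Z"
    using diagonalizes_exists X diagonalizes_def by blast
  have "\<exists>V e. diagonalizes n V e X \<and> diagonalizes n V (\<lambda>i. f (e i)) (matfun f X)"
    unfolding matfun_def n by (rule someI[of _ Z]) (use X Z in blast)
  then obtain V e where "diagonalizes n V e X" "diagonalizes n V (\<lambda>i. f (e i)) (matfun f X)" by blast
  then have "Z = matfun f X" using diagonalized_function_unique[OF X _ Z] by blast
  then show ?thesis using Z by simp
qed

text \<open>The definite description in \<open>mpow\<close> denotes: a witness exists by
  diagonalization, and independence of the eigenbasis makes it unique.\<close>

lemma diagonalizes_mpow:
  assumes X: "diagonalizes n U d X" and pos: "\<And>i. i < n \<Longrightarrow> d i > 0"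
  shows "diagonalizes n U (\<lambda>i. d i powr r) (mpow X r)"
proof -
  have n: "dim_row X = n" using diagonalizes_carrier[OF X] by simp
  obtain Z where Z: "diagonalizes n U (\<lambda>i. d i powr r) Z"
    using diagonalizes_exists X diagonalizes_def by blast
  have "mpow X r = Z"
    unfolding mpow_def n
  proof (rule the_equality)
    show "\<exists>U d. unitary_mat n U \<and> (\<forall>i<n. 0 < d i) \<and>
        X = U * mat_diag n (\<lambda>i. complex_of_real (d i)) * mat_adjoint U \<and>
        Z = U * mat_diag n (\<lambda>i. complex_of_real (d i powr r)) * mat_adjoint U"
      using X Z pos unfolding diagonalizes_def by blast
  next
    fix Z' assume "\<exists>U d. unitary_mat n U \<and> (\<forall>i<n. 0 < d i) \<and>
        X = U * mat_diag n (\<lambda>i. complex_of_real (d i)) * mat_adjoint U \<and>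
        Z' = U * mat_diag n (\<lambda>i. complex_of_real (d i powr r)) * mat_adjoint U"
    then obtain V e where "diagonalizes n V e X" "diagonalizes n V (\<lambda>i. e i powr r) Z'"
      unfolding diagonalizes_def by blast
    then show "Z' = Z"
      using diagonalized_function_unique[OF X _ Z] by blast
  qed
  then show ?thesis using Z by simp
qed

lemma diagonalizes_mult:
  assumes X: "diagonalizes n U d X" and Y: "diagonalizes n U e Y"
  shows "diagonalizes n U (\<lambda>i. d i * e i) (X * Y)"
proof -
  have U: "unitary_mat n U" using X by (simp add: diagonalizes_def)
  note Uc = unitary_carrier[OF U]
  let ?D = "mat_diag n (\<lambda>i. complex_of_real (d i))" and ?E = "mat_diag n (\<lambda>i. complex_of_real (e i))"
  have "X * Y = U * (?D * ((mat_adjoint U * U) * ?E)) * mat_adjoint U"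
    using X Y Uc by (simp add: diagonalizes_def assoc_mult_mat[of _ n n _ n _ n] del: mat_diag_diag)
  then show ?thesis
    using U by (simp add: diagonalizes_def unitary_adjoint_mult left_mult_one_mat[of _ n n])
qed

lemma diagonalizes_one:
  "unitary_mat n U \<Longrightarrow> diagonalizes n U (\<lambda>_. 1) (1\<^sub>m n)"
  using unitary_carrier[of n U] by (simp add: diagonalizes_def unitary_mult_adjoint right_mult_one_mat[of _ n n])

lemma diagonalizes_cong:
  assumes "diagonalizes n U d X" "\<And>i. i < n \<Longrightarrow> d i = e i"
  shows "diagonalizes n U e X"
proof -
  have "mat_diag n (\<lambda>i. complex_of_real (d i)) = mat_diag n (\<lambda>i. complex_of_real (e i))"
    using assms(2) by (intro eq_matI) (auto simp: mat_diag_def)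
  then show ?thesis using assms(1) by (simp add: diagonalizes_def)
qed

lemma diagonalizes_eq: "diagonalizes n U d X \<Longrightarrow> diagonalizes n U d Y \<Longrightarrow> X = Y"
  by (simp add: diagonalizes_def)

text \<open>\<open>minv\<close> chooses some two-sided inverse; uniqueness of inverses identifies it
  with the matrix of reciprocal eigenvalues.\<close>

lemma diagonalizes_minv:
  assumes X: "diagonalizes n U d X" and nz: "\<And>i. i < n \<Longrightarrow> d i \<noteq> 0"
  shows "diagonalizes n U (\<lambda>i. 1 / d i) (minv X)"
proof -
  have U: "unitary_mat n U" using X by (simp add: diagonalizes_def)
  note Xc = diagonalizes_carrier[OF X]
  have n: "dim_row X = n" using Xc by simp
  obtain Z where Z: "diagonalizes n U (\<lambda>i. 1 / d i) Z"
    using diagonalizes_exists[OF U] by blast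
  note Zc = diagonalizes_carrier[OF Z]
  have XZ: "X * Z = 1\<^sub>m n"
    by (rule diagonalizes_eq[OF diagonalizes_cong[OF diagonalizes_mult[OF X Z]] diagonalizes_one[OF U]])
      (simp add: nz)
  have ZX: "Z * X = 1\<^sub>m n"
    by (rule diagonalizes_eq[OF diagonalizes_cong[OF diagonalizes_mult[OF Z X]] diagonalizes_one[OF U]])
      (simp add: nz)
  have "minv X \<in> carrier_mat n n \<and> X * minv X = 1\<^sub>m n \<and> minv X * X = 1\<^sub>m n"
    unfolding minv_def n by (rule someI[of _ Z]) (use XZ ZX Zc in blast)
  then have m: "minv X \<in> carrier_mat n n" "X * minv X = 1\<^sub>m n" by auto
  have "Z = Z * (X * minv X)" using Zc m by simp
  also have "\<dots> = (Z * X) * minv X" using Zc Xc m by (simp add: assoc_mult_mat[of _ n n _ n _ n])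
  also have "\<dots> = minv X" using ZX m by simp
  finally show ?thesis using Z by simp
qed

section \<open>The Loewner order\<close>

definition qform :: "complex mat \<Rightarrow> complex vec \<Rightarrow> real" where
  "qform M v = Re ((M *\<^sub>v v) \<bullet>c v)"

lemma cscalar_prod_form_sum:
  fixes M :: "complex mat"
  assumes "M \<in> carrier_mat n n" "v \<in> carrier_vec n"
  shows "(M *\<^sub>v v) \<bullet>c v = (\<Sum>i<n. \<Sum>j<n. M $$ (i, j) * v $ j * cnj (v $ i))"
proof -
  have "(M *\<^sub>v v) \<bullet>c v = (\<Sum>i<n. (\<Sum>j<n. M $$ (i, j) * v $ j) * cnj (v $ i))"
    using assms by (subst cscalar_prod_sum[of _ n]) (auto simp: scalar_prod_def atLeast0LessThan)
  then show ?thesis by (simp add: sum_distrib_right)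
qed

lemma qform_minus:
  assumes "M \<in> carrier_mat n n" "N \<in> carrier_mat n n" "v \<in> carrier_vec n"
  shows "qform (M - N) v = qform M v - qform N v"
proof -
  have "((M - N) *\<^sub>v v) \<bullet>c v = (M *\<^sub>v v) \<bullet>c v - (N *\<^sub>v v) \<bullet>c v"
    using assms minus_carrier_mat[OF assms(2), of M]
    by (simp add: cscalar_prod_form_sum[of _ n] sum_subtractf left_diff_distrib)
  then show ?thesis by (simp add: qform_def)
qed

lemma qform_scalar:
  assumes "v \<in> carrier_vec n"
  shows "qform (complex_of_real c \<cdot>\<^sub>m 1\<^sub>m n) v = c * (vnorm v)\<^sup>2"
proof -
  have "(complex_of_real c \<cdot>\<^sub>m 1\<^sub>m n) *\<^sub>v v = complex_of_real c \<cdot>\<^sub>v v"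
    using assms by (intro eq_vecI) auto
  then show ?thesis
    using assms cscalar_prod_self[OF assms] by (simp add: qform_def)
qed

lemma qform_congruence:
  assumes "A \<in> carrier_mat n n" "M \<in> carrier_mat n n" "v \<in> carrier_vec n"
  shows "qform (mat_adjoint A * M * A) v = qform M (A *\<^sub>v v)"
  using assms cscalar_prod_adjoint[of "mat_adjoint A" n n "M *\<^sub>v (A *\<^sub>v v)" v]
  by (simp add: qform_def assoc_mult_mat_vec[of _ n n _ n] assoc_mult_mat[of _ n n _ n _ n])

lemma hermitian_minus: "hermitian_mat n P \<Longrightarrow> hermitian_mat n R \<Longrightarrow> hermitian_mat n (P - R)"
  by (auto simp: hermitian_mat_def mat_adjoint_minus[of _ n n] minus_carrier_mat)

lemma hermitian_scalar: "hermitian_mat n (complex_of_real c \<cdot>\<^sub>m 1\<^sub>m n)"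
  by (auto simp: hermitian_mat_def mat_adjoint_smult_of_real)

lemma hermitian_congruence:
  "hermitian_mat n M \<Longrightarrow> A \<in> carrier_mat n n \<Longrightarrow> hermitian_mat n (mat_adjoint A * M * A)"
  by (auto simp: hermitian_mat_def mat_adjoint_mult[of _ n n _ n] assoc_mult_mat[of _ n n _ n _ n])

lemma loewner_le_iff:
  "loewner_le n P R \<longleftrightarrow> hermitian_mat n P \<and> hermitian_mat n R \<and>
     (\<forall>v \<in> carrier_vec n. qform P v \<le> qform R v)"
proof -
  have "psd_mat n (R - P) \<longleftrightarrow> (\<forall>v \<in> carrier_vec n. qform P v \<le> qform R v)"
    if "hermitian_mat n P" "hermitian_mat n R"
    unfolding psd_mat_def qform_def[symmetric]
    using that hermitian_minus[OF that(2) that(1)]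
    by (auto simp: hermitian_mat_def qform_minus[of _ n])
  then show ?thesis unfolding loewner_le_def by blast
qed

lemma diagonalizes_hermitian: "diagonalizes n U d X \<Longrightarrow> hermitian_mat n X"
  using unitary_carrier[of n U]
  by (auto simp: diagonalizes_def hermitian_mat_def mat_adjoint_mult[of _ n n _ n] assoc_mult_mat[of _ n n _ n _ n])

lemma diagonalizes_qform:
  assumes X: "diagonalizes n U d X" and v: "v \<in> carrier_vec n"
  shows "qform X v = (\<Sum>i<n. d i * (cmod ((mat_adjoint U *\<^sub>v v) $ i))\<^sup>2)"
proof -
  have U: "unitary_mat n U" using X by (simp add: diagonalizes_def)
  note Uc = unitary_carrier[OF U]
  let ?D = "mat_diag n (\<lambda>i. complex_of_real (d i))"
  define w where "w = mat_adjoint U *\<^sub>v v"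
  have w: "w \<in> carrier_vec n" using Uc v by (simp add: w_def)
  have "X = mat_adjoint (mat_adjoint U) * ?D * mat_adjoint U"
    using X by (simp add: diagonalizes_def)
  then have "qform X v = qform ?D w"
    using qform_congruence[of "mat_adjoint U" n ?D v] Uc v by (simp add: w_def)
  also have "qform ?D w = (\<Sum>i<n. d i * (cmod (w $ i))\<^sup>2)"
  proof -
    have "?D *\<^sub>v w = vec n (\<lambda>i. complex_of_real (d i) * w $ i)"
    proof (rule eq_vecI)
      fix i assume "i < dim_vec (vec n (\<lambda>i. complex_of_real (d i) * w $ i))"
      then have i: "i < n" by simp
      then have "(?D *\<^sub>v w) $ i = (\<Sum>j = 0..<n. (if i = j then complex_of_real (d j) else 0) * w $ j)"
        using w by (simp add: mat_diag_def scalar_prod_def)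
      also have "\<dots> = (\<Sum>j = 0..<n. if j = i then complex_of_real (d i) * w $ i else 0)"
        by (rule sum.cong) auto
      finally show "(?D *\<^sub>v w) $ i = vec n (\<lambda>i. complex_of_real (d i) * w $ i) $ i"
        using i by simp
    qed (simp add: mat_diag_def)
    then have "(?D *\<^sub>v w) \<bullet>c w = (\<Sum>i<n. complex_of_real (d i * (cmod (w $ i))\<^sup>2))"
      using w by (subst cscalar_prod_sum[of _ n])
        (simp_all add: complex_norm_square mult.assoc del: of_real_power)
    then show ?thesis
      by (simp add: qform_def del: of_real_mult of_real_power)
  qed
  finally show ?thesis unfolding w_def .
qed

lemma diagonalizes_vnorm_sq:
  assumes X: "diagonalizes n U d X" and v: "v \<in> carrier_vec n"
  shows "(vnorm v)\<^sup>2 = (\<Sum>i<n. (cmod ((mat_adjoint U *\<^sub>v v) $ i))\<^sup>2)"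
proof -
  have U: "unitary_mat n U" using X by (simp add: diagonalizes_def)
  show ?thesis
    using unitary_vnorm[OF unitary_adjoint[OF U] v] vnorm_sq[of "mat_adjoint U *\<^sub>v v" n]
      unitary_carrier[OF U] v by simp
qed

lemma diagonalizes_eigenvector:
  assumes X: "diagonalizes n U d X" and i: "i < n"
  shows "X *\<^sub>v col U i = complex_of_real (d i) \<cdot>\<^sub>v col U i" "vnorm (col U i) = 1" "col U i \<in> carrier_vec n"
proof -
  have U: "unitary_mat n U" using X by (simp add: diagonalizes_def)
  note Uc = unitary_carrier[OF U]
  let ?D = "mat_diag n (\<lambda>i. complex_of_real (d i))"
  show c: "col U i \<in> carrier_vec n" using Uc by (rule mat_col_carrier)
  have e: "mat_adjoint U *\<^sub>v col U i = unit_vec n i"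
    using col_mult2[of "mat_adjoint U" n n U n i] Uc i by (simp add: unitary_adjoint_mult[OF U])
  have D: "?D *\<^sub>v unit_vec n i = complex_of_real (d i) \<cdot>\<^sub>v unit_vec n i"
    using i by (intro eq_vecI) (auto simp: mat_diag_def)
  have Ue: "U *\<^sub>v unit_vec n i = col U i"
    using Uc i by (intro eq_vecI) auto
  have "X *\<^sub>v col U i = U *\<^sub>v (?D *\<^sub>v (mat_adjoint U *\<^sub>v col U i))"
    using X Uc c by (simp add: diagonalizes_def assoc_mult_mat_vec[of _ n n _ n])
  also have "\<dots> = complex_of_real (d i) \<cdot>\<^sub>v col U i"
    unfolding e D using mult_mat_vec[OF Uc, of "unit_vec n i"] by (simp add: Ue)
  finally show "X *\<^sub>v col U i = complex_of_real (d i) \<cdot>\<^sub>v col U i" .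
  have "(vnorm (col U i))\<^sup>2 = (vnorm (unit_vec n i))\<^sup>2"
    using unitary_vnorm[OF U, of "unit_vec n i"] by (simp add: Ue)
  also have "\<dots> = (\<Sum>j<n. (cmod (unit_vec n i $ j))\<^sup>2)"
    by (rule vnorm_sq) simp
  also have "\<dots> = (\<Sum>j<n. if j = i then 1 else 0)"
    using i by (intro sum.cong refl) simp
  finally have "(vnorm (col U i))\<^sup>2 = 1" using i by simp
  then show "vnorm (col U i) = 1"
    using vnorm_nonneg[of "col U i"] by (simp add: power2_eq_1_iff)
qed

lemma diagonalizes_qform_col:
  assumes "diagonalizes n U d X" "i < n"
  shows "qform X (col U i) = d i"
  using diagonalizes_eigenvector[OF assms] cscalar_prod_self[of "col U i" n]
  by (simp add: qform_def)

text \<open>Comparison with a scalar matrix is a condition on eigenvalues, tested on the columns of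
  \<open>U\<close>. Scalar bounds can therefore be pushed through monotone scalar functions without
  operator monotonicity.\<close>

lemma diagonalizes_qform_ge_iff:
  assumes X: "diagonalizes n U d X"
  shows "(\<forall>v \<in> carrier_vec n. c * (vnorm v)\<^sup>2 \<le> qform X v) \<longleftrightarrow> (\<forall>i<n. c \<le> d i)"
proof
  assume *: "\<forall>v \<in> carrier_vec n. c * (vnorm v)\<^sup>2 \<le> qform X v"
  show "\<forall>i<n. c \<le> d i"
    using * diagonalizes_eigenvector[OF X] diagonalizes_qform_col[OF X] by force
next
  assume *: "\<forall>i<n. c \<le> d i"
  show "\<forall>v \<in> carrier_vec n. c * (vnorm v)\<^sup>2 \<le> qform X v"
    using * by (auto simp: diagonalizes_qform[OF X] diagonalizes_vnorm_sq[OF X] sum_distrib_left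
        intro!: sum_mono mult_right_mono)
qed

lemma diagonalizes_qform_le_iff:
  assumes X: "diagonalizes n U d X"
  shows "(\<forall>v \<in> carrier_vec n. qform X v \<le> c * (vnorm v)\<^sup>2) \<longleftrightarrow> (\<forall>i<n. d i \<le> c)"
proof
  assume *: "\<forall>v \<in> carrier_vec n. qform X v \<le> c * (vnorm v)\<^sup>2"
  show "\<forall>i<n. d i \<le> c"
    using * diagonalizes_eigenvector[OF X] diagonalizes_qform_col[OF X] by force
next
  assume *: "\<forall>i<n. d i \<le> c"
  show "\<forall>v \<in> carrier_vec n. qform X v \<le> c * (vnorm v)\<^sup>2"
    using * by (auto simp: diagonalizes_qform[OF X] diagonalizes_vnorm_sq[OF X] sum_distrib_left
        intro!: sum_mono mult_right_mono)
qed

lemma pd_mat_diagonalizes: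
  assumes "pd_mat n X"
  obtains U d where "diagonalizes n U d X" "\<And>i. i < n \<Longrightarrow> d i > 0"
proof -
  obtain U d where X: "diagonalizes n U d X"
    using assms hermitian_spectral unfolding pd_mat_def by blast
  have "d i > 0" if i: "i < n" for i
  proof -
    have "col U i \<noteq> 0\<^sub>v n"
      using diagonalizes_eigenvector[OF X i] vnorm_eq_0_iff[of "col U i" n] by auto
    then show ?thesis
      using assms diagonalizes_eigenvector(3)[OF X i] diagonalizes_qform_col[OF X i]
      unfolding pd_mat_def qform_def by force
  qed
  then show ?thesis using that X by blast
qed

lemma pd_matI_qform_ge:
  assumes "hermitian_mat n X" "c > 0" "\<And>v. v \<in> carrier_vec n \<Longrightarrow> c * (vnorm v)\<^sup>2 \<le> qform X v"
  shows "pd_mat n X"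
  unfolding pd_mat_def qform_def[symmetric]
proof (intro conjI ballI impI)
  fix v :: "complex vec" assume v: "v \<in> carrier_vec n" "v \<noteq> 0\<^sub>v n"
  then have "(vnorm v)\<^sup>2 > 0" using vnorm_eq_0_iff[of v n] by simp
  then have "0 < c * (vnorm v)\<^sup>2" using assms(2) by simp
  then show "0 < qform X v" using assms(3)[OF v(1)] by linarith
qed (rule assms)

text \<open>\<open>Max\<close> is meaningful only on a finite set; the real eigenvalues are finitely
  many as roots of the characteristic polynomial.\<close>

lemma diagonalizes_le_lambda1:
  assumes X: "diagonalizes n U d X" and i: "i < n"
  shows "d i \<le> lambda1 X"
proof -
  note Xc = diagonalizes_carrier[OF X]
  have "finite {x. poly (char_poly X) x = 0}"
    using degree_monic_char_poly[OF Xc] i by (intro poly_roots_finite) auto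
  then have "finite (complex_of_real -` {x. poly (char_poly X) x = 0})"
    by (rule finite_vimageI) (simp add: inj_on_def)
  then have fin: "finite {x :: real. eigenvalue X (complex_of_real x)}"
    by (simp add: eigenvalue_root_char_poly[OF Xc] vimage_def)
  have "col U i \<noteq> 0\<^sub>v n"
    using diagonalizes_eigenvector[OF X i] vnorm_eq_0_iff[of "col U i" n] by auto
  then have "eigenvalue X (complex_of_real (d i))"
    using diagonalizes_eigenvector[OF X i] Xc unfolding eigenvalue_def eigenvector_def by auto
  then show ?thesis unfolding lambda1_def using fin by (intro Max_ge) auto
qed

section \<open>Real powers and the Loewner-Heinz inequality\<close>

text \<open>The one-parameter group of powers of a positive definite matrix, over a single
  eigenbasis. Negative and fractional exponents are then handled by adding exponents.\<close>

locale positive_powers =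
  fixes n :: nat and U :: "complex mat" and d :: "nat \<Rightarrow> real" and P :: "real \<Rightarrow> complex mat"
  assumes diag: "\<And>r. diagonalizes n U (\<lambda>i. d i powr r) (P r)"
    and pos: "\<And>i. i < n \<Longrightarrow> d i > 0"
begin

lemma unitary: "unitary_mat n U"
  using diag by (simp add: diagonalizes_def)

lemma carrier [simp]: "P r \<in> carrier_mat n n"
  using diag by (rule diagonalizes_carrier)

lemma adjoint [simp]: "mat_adjoint (P r) = P r"
  using diagonalizes_hermitian[OF diag] by (simp add: hermitian_mat_def)

lemma mult: "P a * P b = P (a + b)"
  using diagonalizes_mult[OF diag[of a] diag[of b]] diag[of "a + b"]
  by (intro diagonalizes_eq[of n U "\<lambda>i. d i powr (a + b)"]) (simp_all add: powr_add)

text \<open>Positivity of the eigenvalues matters: \<open>0 powr 0 = 0\<close> in this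
  formalism.\<close>

lemma zero: "P 0 = 1\<^sub>m n"
  using diagonalizes_eq[OF diagonalizes_cong[OF diag[of 0]] diagonalizes_one[OF unitary]] pos by force

lemma mult_vec: "v \<in> carrier_vec n \<Longrightarrow> P a *\<^sub>v (P b *\<^sub>v v) = P (a + b) *\<^sub>v v"
  by (simp add: mult[symmetric] assoc_mult_mat_vec[of _ n n _ n])

lemma zero_vec: "v \<in> carrier_vec n \<Longrightarrow> P 0 *\<^sub>v v = v"
  by (simp add: zero)

lemma cscalar_prod_swap:
  "x \<in> carrier_vec n \<Longrightarrow> y \<in> carrier_vec n \<Longrightarrow> (P a *\<^sub>v x) \<bullet>c y = x \<bullet>c (P a *\<^sub>v y)"
  using cscalar_prod_adjoint[of "P a" n n x y] by simp

text \<open>\<open>P (a / 2)\<close> is Hermitian with square \<open>P a\<close>. Order hypotheses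
  thus become inequalities between norms, ready for Cauchy-Schwarz.\<close>

lemma qform_power: "v \<in> carrier_vec n \<Longrightarrow> qform (P a) v = (vnorm (P (a / 2) *\<^sub>v v))\<^sup>2"
proof -
  assume v: "v \<in> carrier_vec n"
  have "(P a *\<^sub>v v) \<bullet>c v = (P (a / 2) *\<^sub>v (P (a / 2) *\<^sub>v v)) \<bullet>c v"
    using v by (simp add: mult_vec)
  also have "\<dots> = (P (a / 2) *\<^sub>v v) \<bullet>c (P (a / 2) *\<^sub>v v)"
    using v by (simp add: cscalar_prod_swap)
  finally show ?thesis
    using v cscalar_prod_self[of "P (a / 2) *\<^sub>v v" n] by (simp add: qform_def)
qed

lemma power_vec_eq_0: "v \<in> carrier_vec n \<Longrightarrow> P a *\<^sub>v v = 0\<^sub>v n \<Longrightarrow> v = 0\<^sub>v n"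
proof -
  assume v: "v \<in> carrier_vec n" and z: "P a *\<^sub>v v = 0\<^sub>v n"
  have "v = P (- a) *\<^sub>v (P a *\<^sub>v v)" using v by (simp add: mult_vec zero_vec)
  also have "\<dots> = 0\<^sub>v n"
    unfolding z using carrier[of "- a"] by (intro eq_vecI) (auto simp: scalar_prod_def simp del: carrier)
  finally show ?thesis .
qed

text \<open>In the eigenbasis this is a finite sum of exponentials in \<open>r\<close>; it serves to
  pass from dyadic to real exponents.\<close>

lemma continuous_qform: "v \<in> carrier_vec n \<Longrightarrow> isCont (\<lambda>r. qform (P r) v) r"
  using pos[THEN less_imp_neq] by (auto simp: diagonalizes_qform[OF diag] intro!: continuous_intros)

end

lemma positive_powers_mpow:
  assumes "diagonalizes n U d X" "\<And>i. i < n \<Longrightarrow> d i > 0"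
  shows "positive_powers n U d (mpow X)"
  using assms by unfold_locales (auto intro: diagonalizes_mpow)

text \<open>Pedersen's argument: an eigenvector of \<open>P (-c/2) * R c * P (-c/2)\<close> is transported to an
  eigenvector of \<open>P (-a/2) * R c * P (-b/2)\<close>, whose norm splits into the \<open>a\<close>- and \<open>b\<close>-parts.\<close>

lemma loewner_heinz_midpoint:
  assumes P: "positive_powers n U d P" and R: "positive_powers n V e R"
    and a: "\<And>v. v \<in> carrier_vec n \<Longrightarrow> qform (R a) v \<le> qform (P a) v"
    and b: "\<And>v. v \<in> carrier_vec n \<Longrightarrow> qform (R b) v \<le> qform (P b) v"
    and v: "v \<in> carrier_vec n"
  shows "qform (R ((a + b) / 2)) v \<le> qform (P ((a + b) / 2)) v"
proof -
  interpret P: positive_powers n U d P by (rule P)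
  interpret R: positive_powers n V e R by (rule R)
  define c where "c = (a + b) / 2"
  \<comment> \<open>Conjugation by \<open>P (- c / 2)\<close> turns the claim R^c \<le> P^c into
    \<open>M\<close> \<le> I, which is a bound on the eigenvalues \<open>f i\<close>.\<close>
  define M where "M = P (- c / 2) * R c * P (- c / 2)"
  have Mc: "M \<in> carrier_mat n n" by (simp add: M_def)
  have "hermitian_mat n M"
    by (simp add: hermitian_mat_def M_def mat_adjoint_mult[of _ n n _ n] assoc_mult_mat[of _ n n _ n _ n])
  then obtain Z f where Z: "diagonalizes n Z f M" using hermitian_spectral by blast
  have "f i \<le> 1" if i: "i < n" for i
  proof -
    define x where "x = col Z i"
    have x: "x \<in> carrier_vec n" and Mx: "M *\<^sub>v x = complex_of_real (f i) \<cdot>\<^sub>v x" and nx: "vnorm x = 1"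
      using diagonalizes_eigenvector[OF Z i] by (auto simp: x_def)
    \<comment> \<open>As c = (a + b)/2, the exponent (b - a)/4 equals both b/2 - c/2 and c/2 - a/2.
      So P^(b/2) y = u = P^(a/2) z, and the hypotheses for \<open>b\<close> at \<open>y\<close> and
      for \<open>a\<close> at \<open>z\<close> both bound by the norm of the same vector
      \<open>u\<close>, while R^c pairs \<open>y\<close> with \<open>z\<close> to \<open>f i\<close>
      times the square of that norm.\<close>
    define u where "u = P ((b - a) / 4) *\<^sub>v x"
    define y where "y = P (- c / 2) *\<^sub>v x"
    define z where "z = P (- a / 2) *\<^sub>v u"
    have c [simp]: "u \<in> carrier_vec n" "y \<in> carrier_vec n" "z \<in> carrier_vec n"
      using x by (auto simp: u_def y_def z_def)
    have Py: "P (b / 2) *\<^sub>v y = u"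
      using x by (simp add: y_def u_def P.mult_vec c_def field_simps)
    have Pz: "P (a / 2) *\<^sub>v z = u"
      using x by (simp add: z_def P.mult_vec P.zero_vec)
    have "R c *\<^sub>v y = P 0 *\<^sub>v (R c *\<^sub>v y)" by (simp add: P.zero_vec)
    also have "\<dots> = P (c / 2) *\<^sub>v (P (- c / 2) *\<^sub>v (R c *\<^sub>v y))" by (simp add: P.mult_vec)
    also have "P (- c / 2) *\<^sub>v (R c *\<^sub>v y) = M *\<^sub>v x"
      using x by (simp add: M_def y_def assoc_mult_mat_vec[of _ n n _ n] assoc_mult_mat[of _ n n _ n _ n])
    also have "P (c / 2) *\<^sub>v (M *\<^sub>v x) = complex_of_real (f i) \<cdot>\<^sub>v (P (c / 2) *\<^sub>v x)"
      unfolding Mx using x by (intro mult_mat_vec[of _ n n]) auto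
    finally have Ry: "R c *\<^sub>v y = complex_of_real (f i) \<cdot>\<^sub>v (P (c / 2) *\<^sub>v x)" .
    have "(R c *\<^sub>v y) \<bullet>c z = complex_of_real (f i) * ((P (c / 2) *\<^sub>v x) \<bullet>c z)"
      unfolding Ry using x by (intro smult_scalar_prod_distrib[of _ n]) auto
    also have "(P (c / 2) *\<^sub>v x) \<bullet>c z = (P (- a / 2) *\<^sub>v (P (c / 2) *\<^sub>v x)) \<bullet>c u"
      using x by (simp add: z_def P.cscalar_prod_swap)
    also have "P (- a / 2) *\<^sub>v (P (c / 2) *\<^sub>v x) = u"
    proof -
      have "- a / 2 + c / 2 = (b - a) / 4" by (simp add: c_def)
      then show ?thesis using x by (simp only: u_def P.mult_vec)
    qed
    also have "u \<bullet>c u = complex_of_real ((vnorm u)\<^sup>2)"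
      by (rule cscalar_prod_self[OF c(1)])
    finally have "(R c *\<^sub>v y) \<bullet>c z = complex_of_real (f i * (vnorm u)\<^sup>2)" by simp
    moreover have "(R c *\<^sub>v y) \<bullet>c z = (R (b / 2) *\<^sub>v y) \<bullet>c (R (a / 2) *\<^sub>v z)"
    proof -
      have "a / 2 + b / 2 = c" by (simp add: c_def)
      then have "R c *\<^sub>v y = R (a / 2) *\<^sub>v (R (b / 2) *\<^sub>v y)"
        by (simp add: R.mult_vec)
      then show ?thesis by (simp add: R.cscalar_prod_swap)
    qed
    ultimately have "f i * (vnorm u)\<^sup>2 \<le> cmod ((R (b / 2) *\<^sub>v y) \<bullet>c (R (a / 2) *\<^sub>v z))"
      by (metis abs_ge_self norm_of_real)
    also have "\<dots> \<le> vnorm (R (b / 2) *\<^sub>v y) * vnorm (R (a / 2) *\<^sub>v z)"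
      by (rule cscalar_prod_Cauchy_Schwarz[of _ n]) auto
    also have "\<dots> \<le> vnorm u * vnorm u"
    proof (intro mult_mono)
      show "vnorm (R (b / 2) *\<^sub>v y) \<le> vnorm u"
        by (rule power2_le_imp_le[OF _ vnorm_nonneg]) (use b[of y] in \<open>simp add: P.qform_power R.qform_power Py\<close>)
      show "vnorm (R (a / 2) *\<^sub>v z) \<le> vnorm u"
        by (rule power2_le_imp_le[OF _ vnorm_nonneg]) (use a[of z] in \<open>simp add: P.qform_power R.qform_power Pz\<close>)
    qed auto
    finally have "f i * (vnorm u)\<^sup>2 \<le> 1 * (vnorm u)\<^sup>2" by (simp add: power2_eq_square)
    moreover have "(vnorm u)\<^sup>2 > 0"
    proof -
      have "x \<noteq> 0\<^sub>v n" using nx vnorm_eq_0_iff[OF x] by auto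
      then have "u \<noteq> 0\<^sub>v n" using P.power_vec_eq_0[OF x] unfolding u_def by blast
      then show ?thesis using vnorm_eq_0_iff[of u n] by simp
    qed
    ultimately show ?thesis by (rule mult_right_le_imp_le)
  qed
  then have M1: "\<And>w. w \<in> carrier_vec n \<Longrightarrow> qform M w \<le> 1 * (vnorm w)\<^sup>2"
    using diagonalizes_qform_le_iff[OF Z, of 1] by blast
  \<comment> \<open>Undoing the conjugation transfers \<open>M\<close> \<le> I back to the powers of
    \<open>R\<close> and \<open>P\<close>.\<close>
  have "P (c / 2) * M * P (c / 2) = (P (c / 2) * P (- c / 2)) * R c * (P (- c / 2) * P (c / 2))"
    by (simp only: M_def assoc_mult_mat[of _ n n _ n _ n] square_mult_carrier P.carrier R.carrier)
  then have "R c = mat_adjoint (P (c / 2)) * M * P (c / 2)"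
    by (simp add: P.mult P.zero right_mult_one_mat[of _ n n] left_mult_one_mat[of _ n n])
  then have "qform (R c) v = qform M (P (c / 2) *\<^sub>v v)"
    using qform_congruence[of "P (c / 2)" n M v] Mc v by simp
  also have "\<dots> \<le> (vnorm (P (c / 2) *\<^sub>v v))\<^sup>2"
    using M1[of "P (c / 2) *\<^sub>v v"] v by simp
  also have "\<dots> = qform (P c) v" using v by (simp add: P.qform_power)
  finally show ?thesis unfolding c_def .
qed

text \<open>The admissible exponents contain 0 and 1 and are closed under midpoints. An odd
  numerator \<open>2 * l + 1\<close> over \<open>2 ^ Suc N\<close> is the midpoint of
  \<open>l / 2 ^ N\<close> and \<open>Suc l / 2 ^ N\<close>.\<close>

lemma loewner_heinz_dyadic:
  assumes P: "positive_powers n U d P" and R: "positive_powers n V e R"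
    and le: "\<And>v. v \<in> carrier_vec n \<Longrightarrow> qform (R 1) v \<le> qform (P 1) v"
    and m: "m \<le> 2 ^ N" and v: "v \<in> carrier_vec n"
  shows "qform (R (real m / 2 ^ N)) v \<le> qform (P (real m / 2 ^ N)) v"
  using m v
proof (induction N arbitrary: m v)
  case 0
  interpret P: positive_powers n U d P by (rule P)
  interpret R: positive_powers n V e R by (rule R)
  have "m = 0 \<or> m = 1" using 0 by auto
  then show ?case using le 0 by (auto simp: P.zero R.zero)
next
  case (Suc N)
  show ?case
  proof (cases "even m")
    case True
    then obtain l where l: "m = 2 * l" by blast
    then have "real m / 2 ^ Suc N = real l / 2 ^ N" by simp
    then show ?thesis using Suc l by simp
  next
    case False
    then obtain l where l: "m = 2 * l + 1" using oddE by blast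
    then have eq: "real m / 2 ^ Suc N = (real l / 2 ^ N + real (Suc l) / 2 ^ N) / 2"
      by (simp add: field_simps)
    have "Suc l \<le> 2 ^ N" using l Suc.prems by simp
    then show ?thesis unfolding eq
      by (intro loewner_heinz_midpoint[OF P R] Suc.IH Suc.prems) auto
  qed
qed

text \<open>Dyadic exponents are dense in [0, 1], and for fixed \<open>v\<close> both sides are
  continuous in the exponent.\<close>

theorem loewner_heinz:
  assumes P: "positive_powers n U d P" and R: "positive_powers n V e R"
    and le: "\<And>v. v \<in> carrier_vec n \<Longrightarrow> qform (R 1) v \<le> qform (P 1) v"
    and r: "0 \<le> r" "r \<le> 1" and v: "v \<in> carrier_vec n"
  shows "qform (R r) v \<le> qform (P r) v"
proof -
  interpret P: positive_powers n U d P by (rule P)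
  interpret R: positive_powers n V e R by (rule R)
  \<comment> \<open>Dyadic approximation of \<open>r\<close> from below; \<open>r\<close> \<le> 1
    keeps the numerator within \<open>2 ^ N\<close>.\<close>
  define m where "m N = nat \<lfloor>r * 2 ^ N\<rfloor>" for N
  have m: "real (m N) = of_int \<lfloor>r * 2 ^ N\<rfloor>" for N
    using r by (simp add: m_def)
  have mle: "m N \<le> 2 ^ N" for N
  proof -
    have "real (m N) \<le> r * 2 ^ N" unfolding m by simp
    also have "\<dots> \<le> 1 * 2 ^ N" using r by (intro mult_right_mono) auto
    finally have "real (m N) \<le> real (2 ^ N)" by simp
    then show ?thesis by (simp only: of_nat_le_iff)
  qed
  have "(\<lambda>N. real (m N) / 2 ^ N) \<longlonglongrightarrow> r"
  proof (rule tendsto_sandwich[of "\<lambda>N. r - (1 / 2) ^ N" _ _ "\<lambda>N. r"])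
    have "r - (1 / 2) ^ N \<le> real (m N) / 2 ^ N" for N
    proof -
      have "r * 2 ^ N - 1 \<le> real (m N)" unfolding m by linarith
      then have "(r * 2 ^ N - 1) / 2 ^ N \<le> real (m N) / 2 ^ N" by (intro divide_right_mono) auto
      then show ?thesis by (simp add: diff_divide_distrib power_divide)
    qed
    then show "\<forall>\<^sub>F N in sequentially. r - (1 / 2) ^ N \<le> real (m N) / 2 ^ N" by simp
    have "real (m N) / 2 ^ N \<le> r" for N
      unfolding m by (simp add: divide_le_eq)
    then show "\<forall>\<^sub>F N in sequentially. real (m N) / 2 ^ N \<le> r" by simp
    show "(\<lambda>N. r - (1 / 2) ^ N) \<longlonglongrightarrow> r"
      using tendsto_diff[OF tendsto_const LIMSEQ_power_zero[of "1 / 2 :: real"], of r] by simp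
  qed simp
  then have "(\<lambda>N. qform (R (real (m N) / 2 ^ N)) v) \<longlonglongrightarrow> qform (R r) v"
    "(\<lambda>N. qform (P (real (m N) / 2 ^ N)) v) \<longlonglongrightarrow> qform (P r) v"
    using isCont_tendsto_compose[OF R.continuous_qform[OF v]]
      isCont_tendsto_compose[OF P.continuous_qform[OF v]] by blast+
  then show ?thesis
    by (rule LIMSEQ_le) (use loewner_heinz_dyadic[OF P R le mle v] in blast)
qed

section \<open>Form and norm bounds for the coefficient matrices\<close>

text \<open>From A Q^(-1) A* \<le> c I to A*A \<le> c Q. With y = Av, the square of the norm of y is
  the product of Q^(1/2) v with Q^(-1/2) A* y; Cauchy-Schwarz and the hypothesis at y bound its
  square by c times the form of Q at v times that same squared norm, one factor of which
  cancels.\<close>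

lemma vnorm_mult_sq_le_of_inverse_bound:
  assumes A: "A \<in> carrier_mat n n" and Q: "diagonalizes n U d Q" and pos: "\<And>i. i < n \<Longrightarrow> d i > 0"
    and c: "c \<ge> 0"
    and bnd: "\<And>v. v \<in> carrier_vec n \<Longrightarrow> qform (A * minv Q * mat_adjoint A) v \<le> c * (vnorm v)\<^sup>2"
    and v: "v \<in> carrier_vec n"
  shows "(vnorm (A *\<^sub>v v))\<^sup>2 \<le> c * qform Q v"
proof -
  interpret P: positive_powers n U d "mpow Q" by (rule positive_powers_mpow[OF Q pos])
  have P1: "mpow Q 1 = Q"
    using diagonalizes_eq[OF diagonalizes_cong[OF P.diag[of 1]] Q] pos by (simp add: less_imp_le)
  have Pm1: "mpow Q (- 1) = minv Q"
    using diagonalizes_eq[OF P.diag[of "- 1"] diagonalizes_cong[OF diagonalizes_minv[OF Q]]] pos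
    by (simp add: powr_minus_divide less_imp_le less_imp_neq[THEN not_sym])
  define y where "y = A *\<^sub>v v"
  define x where "x = mat_adjoint A *\<^sub>v y"
  have cc [simp]: "y \<in> carrier_vec n" "x \<in> carrier_vec n" using A v by (auto simp: x_def y_def)
  have nn: "0 \<le> qform Q v" using v P.qform_power[of v 1] by (simp add: P1)
  have "complex_of_real ((vnorm y)\<^sup>2) = y \<bullet>c y" by (simp add: cscalar_prod_self[of _ n])
  also have "\<dots> = v \<bullet>c x"
    unfolding x_def y_def using A v by (subst cscalar_prod_adjoint[of A n n]) auto
  also have "\<dots> = (mpow Q (1 / 2) *\<^sub>v (mpow Q (- 1 / 2) *\<^sub>v v)) \<bullet>c x"
    using v by (simp add: P.mult_vec P.zero_vec)
  also have "mpow Q (1 / 2) *\<^sub>v (mpow Q (- 1 / 2) *\<^sub>v v) = mpow Q (- 1 / 2) *\<^sub>v (mpow Q (1 / 2) *\<^sub>v v)"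
    using v by (simp add: P.mult_vec)
  also have "\<dots> \<bullet>c x = (mpow Q (1 / 2) *\<^sub>v v) \<bullet>c (mpow Q (- 1 / 2) *\<^sub>v x)"
    using v by (simp add: P.cscalar_prod_swap)
  finally have "cmod (complex_of_real ((vnorm y)\<^sup>2)) \<le> vnorm (mpow Q (1 / 2) *\<^sub>v v) * vnorm (mpow Q (- 1 / 2) *\<^sub>v x)"
    using cscalar_prod_Cauchy_Schwarz[of "mpow Q (1 / 2) *\<^sub>v v" n "mpow Q (- 1 / 2) *\<^sub>v x"] v
    by simp
  then have "(vnorm y)\<^sup>2 \<le> vnorm (mpow Q (1 / 2) *\<^sub>v v) * vnorm (mpow Q (- 1 / 2) *\<^sub>v x)"
    by (simp add: norm_power)
  then have "((vnorm y)\<^sup>2)\<^sup>2 \<le> (vnorm (mpow Q (1 / 2) *\<^sub>v v) * vnorm (mpow Q (- 1 / 2) *\<^sub>v x))\<^sup>2"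
    by (intro power_mono) auto
  also have "\<dots> = qform Q v * qform (minv Q) x"
    using v P.qform_power[of v 1] P.qform_power[of x "- 1"] by (simp add: power_mult_distrib P1 Pm1)
  also have "qform (minv Q) x = qform (A * minv Q * mat_adjoint A) y"
    using qform_congruence[of "mat_adjoint A" n "minv Q" y] A P.carrier[of "- 1"] by (simp add: x_def Pm1)
  also have "qform Q v * \<dots> \<le> qform Q v * (c * (vnorm y)\<^sup>2)"
    using bnd[of y] nn by (intro mult_left_mono) auto
  finally have *: "(vnorm y)\<^sup>2 * (vnorm y)\<^sup>2 \<le> (c * qform Q v) * (vnorm y)\<^sup>2"
    by (simp add: power2_eq_square mult_ac)
  show ?thesis
  proof (cases "(vnorm y)\<^sup>2 = 0")
    case True
    then show ?thesis using c nn by (simp add: y_def)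
  next
    case False
    then have "(vnorm y)\<^sup>2 > 0" by simp
    then show ?thesis using * unfolding y_def by (rule mult_right_le_imp_le[rotated])
  qed
qed

text \<open>The supremum defining \<open>spec_norm\<close> is an upper bound only once the set is
  known to be bounded above. Boundedness comes from diagonalizing A*A, and homogeneity extends the
  bound from unit vectors to all vectors.\<close>

lemma spec_norm_bound:
  assumes A: "A \<in> carrier_mat n n" and v: "v \<in> carrier_vec n"
  shows "vnorm (A *\<^sub>v v) \<le> spec_norm A * vnorm v"
proof -
  have h: "hermitian_mat n (mat_adjoint A * 1\<^sub>m n * A)"
    using hermitian_congruence[OF _ A] hermitian_scalar[of n 1] by (simp add: hermitian_mat_def)
  then obtain U d where D: "diagonalizes n U d (mat_adjoint A * 1\<^sub>m n * A)"
    using hermitian_spectral by blast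
  \<comment> \<open>A crude upper bound for the eigenvalues of A*A; its size is irrelevant, since it
    only shows boundedness.\<close>
  define c where "c = (\<Sum>i<n. \<bar>d i\<bar>)"
  have "d i \<le> c" if "i < n" for i
  proof -
    have "\<bar>d i\<bar> \<le> c" unfolding c_def using that by (intro member_le_sum) auto
    then show ?thesis by simp
  qed
  then have c: "qform (mat_adjoint A * 1\<^sub>m n * A) w \<le> c * (vnorm w)\<^sup>2" if "w \<in> carrier_vec n" for w
    using diagonalizes_qform_le_iff[OF D, of c] that by blast
  have Aw: "(vnorm (A *\<^sub>v w))\<^sup>2 \<le> c * (vnorm w)\<^sup>2" if "w \<in> carrier_vec n" for w
  proof -
    have "qform (mat_adjoint A * 1\<^sub>m n * A) w = qform (1\<^sub>m n) (A *\<^sub>v w)"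
      using A that by (intro qform_congruence) auto
    also have "\<dots> = (vnorm (A *\<^sub>v w))\<^sup>2"
      using A that cscalar_prod_self[of "A *\<^sub>v w" n] by (simp add: qform_def)
    finally show ?thesis using c[OF that] by simp
  qed
  let ?S = "{vnorm (A *\<^sub>v v) | v. v \<in> carrier_vec (dim_col A) \<and> vnorm v = 1}"
  have bdd: "bdd_above ?S"
  proof (rule bdd_aboveI)
    fix x assume "x \<in> ?S"
    then obtain w where w: "w \<in> carrier_vec n" "vnorm w = 1" "x = vnorm (A *\<^sub>v w)" using A by auto
    then have "x\<^sup>2 \<le> c" using Aw[OF w(1)] by simp
    then show "x \<le> sqrt c" by (rule real_le_rsqrt)
  qed
  show ?thesis
  proof (cases "vnorm v = 0")
    case True
    then have "(vnorm (A *\<^sub>v v))\<^sup>2 \<le> 0" using Aw[OF v] by simp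
    then show ?thesis using True by simp
  next
    case False
    then have p: "vnorm v > 0" using vnorm_nonneg[of v] by linarith
    define w where "w = complex_of_real (1 / vnorm v) \<cdot>\<^sub>v v"
    have w: "w \<in> carrier_vec n" "vnorm w = 1"
      using v p unfolding w_def by (simp_all add: vnorm_smult[of _ n] del: of_real_divide)
    have "A *\<^sub>v w = complex_of_real (1 / vnorm v) \<cdot>\<^sub>v (A *\<^sub>v v)"
      unfolding w_def by (rule mult_mat_vec[OF A v])
    then have "vnorm (A *\<^sub>v w) = 1 / vnorm v * vnorm (A *\<^sub>v v)"
      using p A v by (simp add: vnorm_smult[of _ n] del: of_real_divide)
    moreover have "vnorm (A *\<^sub>v w) \<le> spec_norm A"
      unfolding spec_norm_def using w A by (intro cSup_upper bdd) auto
    ultimately have "1 / vnorm v * vnorm (A *\<^sub>v v) \<le> spec_norm A" by simp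
    then show ?thesis using p by (simp add: pos_divide_le_eq)
  qed
qed

section \<open>Lipschitz self-maps of the Hermitian matrices\<close>

definition frob_norm :: "complex mat \<Rightarrow> real" where
  "frob_norm M = sqrt (frob_sq M)"

lemma frob_norm_nonneg [simp]: "0 \<le> frob_norm M"
  by (simp add: frob_norm_def)

lemma frob_norm_le_iff: "c \<ge> 0 \<Longrightarrow> frob_norm M \<le> c * frob_norm N \<longleftrightarrow> frob_sq M \<le> c\<^sup>2 * frob_sq N"
proof -
  assume "c \<ge> 0"
  then have "c * frob_norm N = sqrt (c\<^sup>2 * frob_sq N)"
    by (simp add: frob_norm_def real_sqrt_mult)
  then show ?thesis by (simp add: frob_norm_def)
qed

lemma frob_norm_triangle:
  assumes "M \<in> carrier_mat n m" "N \<in> carrier_mat n m"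
  shows "frob_norm (M + N) \<le> frob_norm M + frob_norm N"
proof -
  let ?I = "{..<n} \<times> {..<m}"
  have L2: "frob_norm K = L2_set (\<lambda>(i, j). cmod (K $$ (i, j))) ?I" if "K \<in> carrier_mat n m" for K
    using that by (auto simp: frob_norm_def frob_sq_def L2_set_def sum.cartesian_product case_prod_unfold)
  have "frob_norm (M + N) = L2_set (\<lambda>(i, j). cmod ((M + N) $$ (i, j))) ?I"
    using assms by (intro L2) auto
  also have "\<dots> \<le> L2_set (\<lambda>x. (case x of (i, j) \<Rightarrow> cmod (M $$ (i, j))) + (case x of (i, j) \<Rightarrow> cmod (N $$ (i, j)))) ?I"
    using assms by (intro L2_set_mono) (auto intro: norm_triangle_ineq)
  also have "\<dots> \<le> frob_norm M + frob_norm N"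
    unfolding L2[OF assms(1)] L2[OF assms(2)] by (rule L2_set_triangle_ineq)
  finally show ?thesis .
qed

lemma frob_sq_left_mult_le:
  assumes A: "A \<in> carrier_mat n n" and Z: "Z \<in> carrier_mat n n"
    and a: "\<And>v. v \<in> carrier_vec n \<Longrightarrow> vnorm (A *\<^sub>v v) \<le> a * vnorm v"
  shows "frob_sq (A * Z) \<le> a\<^sup>2 * frob_sq Z"
proof -
  have "(vnorm (col (A * Z) j))\<^sup>2 \<le> a\<^sup>2 * (vnorm (col Z j))\<^sup>2" if "j < n" for j
  proof -
    have "(vnorm (A *\<^sub>v col Z j))\<^sup>2 \<le> (a * vnorm (col Z j))\<^sup>2"
      using a[OF mat_col_carrier[OF Z]] by (intro power_mono) auto
    then show ?thesis using col_mult2[OF A Z that] by (simp add: power_mult_distrib)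
  qed
  then show ?thesis
    using A Z by (auto simp: frob_sq_cols[of _ n n] sum_distrib_left intro!: sum_mono)
qed

text \<open>The adjoint has no larger norm: with w = A* v, the squared norm of w is the product of
  Aw with v, hence at most \<open>spec_norm A * vnorm w * vnorm v\<close>, and one factor
  \<open>vnorm w\<close> cancels.\<close>

lemma vnorm_adjoint_bound:
  assumes A: "A \<in> carrier_mat n n" and v: "v \<in> carrier_vec n"
  shows "vnorm (mat_adjoint A *\<^sub>v v) \<le> spec_norm A * vnorm v"
proof -
  define w where "w = mat_adjoint A *\<^sub>v v"
  have w: "w \<in> carrier_vec n" using A v by (simp add: w_def)
  have Aw: "A *\<^sub>v w \<in> carrier_vec n" using A w by simp
  have "complex_of_real ((vnorm w)\<^sup>2) = w \<bullet>c w" using w by (simp add: cscalar_prod_self[of _ n])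
  also have "\<dots> = (A *\<^sub>v w) \<bullet>c v" unfolding cscalar_prod_adjoint[OF A w v] by (simp add: w_def)
  finally have "cmod (complex_of_real ((vnorm w)\<^sup>2)) \<le> vnorm (A *\<^sub>v w) * vnorm v"
    using cscalar_prod_Cauchy_Schwarz[OF Aw v] by (simp only:)
  then have "(vnorm w)\<^sup>2 \<le> vnorm (A *\<^sub>v w) * vnorm v" by (simp add: norm_power)
  also have "\<dots> \<le> (spec_norm A * vnorm w) * vnorm v"
    using spec_norm_bound[OF A w] by (intro mult_right_mono) auto
  finally have *: "vnorm w * vnorm w \<le> (spec_norm A * vnorm v) * vnorm w"
    by (simp add: power2_eq_square mult_ac)
  have "0 \<le> spec_norm A * vnorm v"
    using spec_norm_bound[OF A v] vnorm_nonneg[of "A *\<^sub>v v"] by linarith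
  then show ?thesis
    using * vnorm_nonneg[of w] unfolding w_def[symmetric]
    by (cases "vnorm w = 0") (auto intro: mult_right_le_imp_le[of "vnorm w" "vnorm w"])
qed

text \<open>Each factor costs one spectral norm. The right factor becomes a left factor by taking
  adjoints, which preserves the Frobenius norm.\<close>

lemma frob_norm_congruence_le:
  assumes A: "A \<in> carrier_mat n n" and Z: "Z \<in> carrier_mat n n"
  shows "frob_norm (mat_adjoint A * Z * A) \<le> (spec_norm A)\<^sup>2 * frob_norm Z"
proof -
  have "frob_sq (mat_adjoint A * Z * A) = frob_sq (mat_adjoint A * (Z * A))"
    using A Z by (simp add: assoc_mult_mat[of _ n n _ n _ n])
  also have "\<dots> \<le> (spec_norm A)\<^sup>2 * frob_sq (Z * A)"
    using A Z by (intro frob_sq_left_mult_le[of _ n] vnorm_adjoint_bound) auto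
  also have "frob_sq (Z * A) = frob_sq (mat_adjoint A * mat_adjoint Z)"
    using A Z by (metis frob_sq_adjoint mat_adjoint_mult)
  also have "(spec_norm A)\<^sup>2 * \<dots> \<le> (spec_norm A)\<^sup>2 * ((spec_norm A)\<^sup>2 * frob_sq (mat_adjoint Z))"
    using A Z by (intro mult_left_mono frob_sq_left_mult_le[of _ n] vnorm_adjoint_bound) auto
  finally have "frob_sq (mat_adjoint A * Z * A) \<le> ((spec_norm A)\<^sup>2)\<^sup>2 * frob_sq Z"
    unfolding frob_sq_adjoint by (simp add: power2_eq_square mult.assoc)
  then show ?thesis by (subst frob_norm_le_iff) auto
qed

lemma frob_sq_diagonalized:
  assumes X: "diagonalizes n U d X"
  shows "frob_sq X = (\<Sum>i<n. (d i)\<^sup>2)"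
proof -
  have U: "unitary_mat n U" using X by (simp add: diagonalizes_def)
  note Uc = unitary_carrier[OF U]
  let ?D = "mat_diag n (\<lambda>i. complex_of_real (d i))"
  have "frob_sq X = frob_sq ?D"
    using X Uc frob_sq_unitary_right[OF unitary_adjoint[OF U], of "U * ?D"] frob_sq_unitary_left[OF U, of ?D]
    by (simp add: diagonalizes_def)
  also have "\<dots> = (\<Sum>i<n. \<Sum>j<n. if j = i then (d i)\<^sup>2 else 0)"
    unfolding frob_sq_def by (intro sum.cong) (auto simp: mat_diag_def)
  finally show ?thesis by simp
qed

text \<open>Brouwer in the real and imaginary parts of the entries. A bounded map on all Hermitian
  matrices has its values in a cube, and the Lipschitz bound supplies coordinatewise continuity; the
  size of \<open>L\<close> does not matter.\<close>

lemma hermitian_fixed_point: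
  fixes G :: "complex mat \<Rightarrow> complex mat"
  assumes herm: "\<And>X. hermitian_mat n X \<Longrightarrow> hermitian_mat n (G X)"
    and bnd: "\<And>X. hermitian_mat n X \<Longrightarrow> frob_norm (G X) \<le> R"
    and lip: "\<And>X Y. hermitian_mat n X \<Longrightarrow> hermitian_mat n Y \<Longrightarrow> frob_norm (G X - G Y) \<le> L * frob_norm (X - Y)"
  shows "\<exists>X. hermitian_mat n X \<and> G X = X"
proof -
  define J where "J = {..<n} \<times> {..<n} \<times> (UNIV :: bool set)"
  define part where "part b z = (if b then Re z else Im z)" for b z
  \<comment> \<open>Averaging over \<open>(i, j)\<close> and \<open>(j, i)\<close> makes
    \<open>H x\<close> Hermitian for every real family \<open>x\<close>, so \<open>F\<close> is
    defined on all families although the coordinates are redundant.\<close>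
  define H where "H x = mat n n (\<lambda>(i, j). Complex ((x (i, j, True) + x (j, i, True)) / 2)
      ((x (i, j, False) - x (j, i, False)) / 2))" for x :: "nat \<times> nat \<times> bool \<Rightarrow> real"
  define F where "F x = (\<lambda>(i, j, b). part b (G (H x) $$ (i, j)))" for x
  have H: "hermitian_mat n (H x)" for x
    by (auto simp: hermitian_mat_def H_def complex_eq_iff diff_divide_distrib intro!: eq_matI)
  have Hc: "H x \<in> carrier_mat n n" for x by (simp add: H_def)
  have Gc: "G (H x) \<in> carrier_mat n n" for x
    using herm[OF H] by (simp add: hermitian_mat_def)
  have part_le: "\<bar>part b z\<bar> \<le> cmod z" for b z
    by (simp add: part_def abs_Re_le_cmod abs_Im_le_cmod)
  have entry: "cmod (M $$ (i, j)) \<le> frob_norm M" if "M \<in> carrier_mat n n" "i < n" "j < n" for M i j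
    using frob_sq_entry_le[of i M j] that unfolding frob_norm_def by (intro real_le_rsqrt) auto
  have "\<exists>x. \<forall>j\<in>J. F x j = x j"
  \<comment> \<open>The cube needs a positive radius, while \<open>R\<close> is arbitrary.\<close>
  proof (rule brouwer_bounded_coordinatewise[of J "max R 1"])
    show "finite J" by (simp add: J_def)
    show "0 < max R 1" by simp
    fix x a assume "a \<in> J"
    then obtain i j b where a: "a = (i, j, b)" "i < n" "j < n" by (auto simp: J_def)
    have "\<bar>F x a\<bar> \<le> cmod (G (H x) $$ (i, j))" using part_le by (simp add: F_def a)
    also have "\<dots> \<le> frob_norm (G (H x))" using a Gc by (intro entry) auto
    also have "\<dots> \<le> R" by (rule bnd[OF H])
    finally show "\<bar>F x a\<bar> \<le> max R 1" by simp
  next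
    fix X :: "nat \<Rightarrow> nat \<times> nat \<times> bool \<Rightarrow> real" and x a
    assume lim: "\<And>i. i \<in> J \<Longrightarrow> (\<lambda>k. X k i) \<longlonglongrightarrow> x i" and "a \<in> J"
    then obtain i j b where a: "a = (i, j, b)" "i < n" "j < n" by (auto simp: J_def)
    have "(\<lambda>k. (H (X k) - H x) $$ (i, j)) \<longlonglongrightarrow> 0" if "i < n" "j < n" for i j
    proof -
      have "(\<lambda>k. Complex ((X k (i, j, True) + X k (j, i, True)) / 2) ((X k (i, j, False) - X k (j, i, False)) / 2))
          \<longlonglongrightarrow> Complex ((x (i, j, True) + x (j, i, True)) / 2) ((x (i, j, False) - x (j, i, False)) / 2)"
        using that
        by (intro tendsto_Complex tendsto_divide tendsto_add tendsto_diff lim tendsto_const) (auto simp: J_def)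
      then have "(\<lambda>k. H (X k) $$ (i, j)) \<longlonglongrightarrow> H x $$ (i, j)" using that by (simp add: H_def)
      from LIM_zero[OF this] show ?thesis using that Hc[of x] by simp
    qed
    then have "(\<lambda>k. \<Sum>i<n. \<Sum>j<n. (cmod ((H (X k) - H x) $$ (i, j)))\<^sup>2) \<longlonglongrightarrow> (\<Sum>i<n. \<Sum>j<n. (cmod 0)\<^sup>2)"
      by (intro tendsto_sum tendsto_power tendsto_norm) auto
    then have "(\<lambda>k. frob_sq (H (X k) - H x)) \<longlonglongrightarrow> 0"
      by (simp add: frob_sq_def H_def)
    then have "(\<lambda>k. L * frob_norm (H (X k) - H x)) \<longlonglongrightarrow> L * sqrt 0"
      unfolding frob_norm_def by (intro tendsto_mult tendsto_const tendsto_real_sqrt)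
    then have z: "(\<lambda>k. L * frob_norm (H (X k) - H x)) \<longlonglongrightarrow> 0" by simp
    have "\<bar>F (X k) a - F x a\<bar> \<le> L * frob_norm (H (X k) - H x)" for k
    proof -
      have "F (X k) a - F x a = part b ((G (H (X k)) - G (H x)) $$ (i, j))"
        using a Gc[of x] by (auto simp: F_def part_def)
      then have "\<bar>F (X k) a - F x a\<bar> \<le> cmod ((G (H (X k)) - G (H x)) $$ (i, j))"
        using part_le by simp
      also have "\<dots> \<le> frob_norm (G (H (X k)) - G (H x))"
        using a by (intro entry minus_carrier_mat Gc) auto
      also have "\<dots> \<le> L * frob_norm (H (X k) - H x)" by (rule lip[OF H H])
      finally show ?thesis .
    qed
    then have "\<forall>\<^sub>F k in sequentially. norm (F (X k) a - F x a) \<le> L * frob_norm (H (X k) - H x)"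
      by (intro always_eventually allI) simp
    from Lim_null_comparison[OF this z] show "(\<lambda>k. F (X k) a) \<longlonglongrightarrow> F x a"
      by (rule LIM_zero_cancel)
  qed
  then obtain x where x: "\<And>j. j \<in> J \<Longrightarrow> F x j = x j" by blast
  \<comment> \<open>At the fixed point \<open>x\<close> holds the parts of the Hermitian matrix
    \<open>G (H x)\<close>, so averaging changes nothing.\<close>
  have "H x = G (H x)"
  proof (rule eq_matI)
    fix i j assume "i < dim_row (G (H x))" "j < dim_col (G (H x))"
    then have ij: "i < n" "j < n" using Gc[of x] by auto
    have xe: "x (i, j, b) = part b (G (H x) $$ (i, j))" if "i < n" "j < n" for i j b
      using x[of "(i, j, b)"] that by (simp add: J_def F_def)
    have "mat_adjoint (G (H x)) = G (H x)" using herm[OF H] by (simp add: hermitian_mat_def)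
    then have "G (H x) $$ (j, i) = mat_adjoint (G (H x)) $$ (j, i)" by simp
    also have "\<dots> = cnj (G (H x) $$ (i, j))" using ij Gc[of x] by simp
    finally have adj: "G (H x) $$ (j, i) = cnj (G (H x) $$ (i, j))" .
    have "H x $$ (i, j) = Complex ((x (i, j, True) + x (j, i, True)) / 2) ((x (i, j, False) - x (j, i, False)) / 2)"
      using ij by (simp add: H_def)
    also have "\<dots> = G (H x) $$ (i, j)"
      unfolding xe[OF ij] xe[OF ij(2,1)] adj by (simp add: part_def complex_eq_iff)
    finally show "H x $$ (i, j) = G (H x) $$ (i, j)" .
  qed (use Gc[of x] Hc[of x] in auto)
  then show ?thesis using H by metis
qed

section \<open>One-variable estimates for powers\<close>

lemma powr_diff_MVT:
  fixes x y r :: real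
  assumes "0 < x" "x \<le> y"
  shows "\<exists>z. x \<le> z \<and> z \<le> y \<and> y powr r - x powr r = (y - x) * (r * z powr (r - 1))"
proof (cases "x = y")
  case False
  then have "x < y" using assms by simp
  moreover have "((\<lambda>u. u powr r) has_real_derivative r * u powr (r - 1)) (at u)" if "x \<le> u" for u
    using has_real_derivative_powr[of u r] that assms by simp
  ultimately obtain z where "x < z" "z < y" "y powr r - x powr r = (y - x) * (r * z powr (r - 1))"
    using MVT2[of x y "\<lambda>u. u powr r" "\<lambda>u. r * u powr (r - 1)"] by blast
  then show ?thesis by (intro exI[of _ z]) auto
qed auto

text \<open>For \<open>r\<close> \<le> 1 the slope \<open>r * z powr (r - 1)\<close> is largest in
  absolute value at the left end \<open>m\<close>. Both negative exponents and the root exponent 1/s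
  are covered.\<close>

lemma abs_powr_diff_le:
  fixes x y m r :: real
  assumes m: "0 < m" "m \<le> x" "m \<le> y" and r: "r \<le> 1"
  shows "\<bar>x powr r - y powr r\<bar> \<le> \<bar>r\<bar> * m powr (r - 1) * \<bar>x - y\<bar>"
proof -
  have *: "\<bar>y powr r - x powr r\<bar> \<le> \<bar>r\<bar> * m powr (r - 1) * \<bar>y - x\<bar>" if xy: "m \<le> x" "x \<le> y" for x y
  proof -
    obtain z where z: "x \<le> z" "y powr r - x powr r = (y - x) * (r * z powr (r - 1))"
      using powr_diff_MVT[of x y r] xy m by auto
    have "z powr (r - 1) \<le> m powr (r - 1)"
      using z xy m r by (intro powr_mono2') auto
    then show ?thesis
      unfolding z(2) abs_mult by (simp add: mult_ac mult_left_mono)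
  qed
  show ?thesis
    using *[of x y] *[of y x] m by (cases "x \<le> y") (auto simp: abs_minus_commute)
qed

text \<open>For \<open>r\<close> \<ge> 1 the slope increases, so it is smallest at \<open>m\<close>;
  this is the expansion bound behind uniqueness.\<close>

lemma abs_powr_diff_ge:
  fixes x y m r :: real
  assumes m: "0 < m" "m \<le> x" "m \<le> y" and r: "r \<ge> 1"
  shows "r * m powr (r - 1) * \<bar>x - y\<bar> \<le> \<bar>x powr r - y powr r\<bar>"
proof -
  have *: "r * m powr (r - 1) * \<bar>y - x\<bar> \<le> \<bar>y powr r - x powr r\<bar>" if xy: "m \<le> x" "x \<le> y" for x y
  proof -
    obtain z where z: "x \<le> z" "y powr r - x powr r = (y - x) * (r * z powr (r - 1))"
      using powr_diff_MVT[of x y r] xy m by auto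
    have "m powr (r - 1) \<le> z powr (r - 1)"
      using z xy m r by (intro powr_mono2) auto
    then show ?thesis
      unfolding z(2) abs_mult using r by (simp add: mult_ac mult_left_mono)
  qed
  show ?thesis
    using *[of x y] *[of y x] m by (cases "x \<le> y") (auto simp: abs_minus_commute)
qed

section \<open>The matrix equation\<close>

lemma mat_add_add_eq_iff:
  fixes P :: "complex mat"
  assumes "P \<in> carrier_mat n n" "M \<in> carrier_mat n n" "N \<in> carrier_mat n n" "Q \<in> carrier_mat n n"
  shows "P + M + N = Q \<longleftrightarrow> P = Q - M - N"
proof
  assume "P + M + N = Q"
  then show "P = Q - M - N" using assms by (intro eq_matI) auto
next
  assume "P = Q - M - N"
  then show "P + M + N = Q" using assms by (intro eq_matI) auto
qed

lemma diagonalizes_smult: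
  assumes X: "diagonalizes n U d X"
  shows "diagonalizes n U (\<lambda>i. c * d i) (complex_of_real c \<cdot>\<^sub>m X)"
proof -
  have U: "unitary_mat n U" using X by (simp add: diagonalizes_def)
  note Uc = unitary_carrier[OF U]
  have "mat_diag n (\<lambda>i. complex_of_real (c * d i)) = complex_of_real c \<cdot>\<^sub>m mat_diag n (\<lambda>i. complex_of_real (d i))"
    by (intro eq_matI) (auto simp: mat_diag_def)
  then show ?thesis
    using X Uc by (simp add: diagonalizes_def mult_smult_distrib[of _ n n _ n] mult_smult_assoc_mat[of _ n n _ n])
qed

definition clamped_inv_pow :: "real \<Rightarrow> real \<Rightarrow> complex mat \<Rightarrow> complex mat" where
  "clamped_inv_pow m r X = matfun (\<lambda>x. max x m powr (- r)) X"

lemma clamped_inv_pow_hermitian: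
  "hermitian_mat n X \<Longrightarrow> hermitian_mat n (clamped_inv_pow m r X)"
  unfolding clamped_inv_pow_def using hermitian_spectral diagonalizes_matfun diagonalizes_hermitian by blast

lemma clamped_inv_pow_qform:
  assumes X: "hermitian_mat n X" and m: "0 < m" and r: "0 \<le> r" and v: "v \<in> carrier_vec n"
  shows "0 \<le> qform (clamped_inv_pow m r X) v"
    and "qform (clamped_inv_pow m r X) v \<le> m powr (- r) * (vnorm v)\<^sup>2"
proof -
  obtain U d where D: "diagonalizes n U d X" using hermitian_spectral[OF X] by blast
  note Z = diagonalizes_matfun[OF D, of "\<lambda>x. max x m powr (- r)", folded clamped_inv_pow_def]
  show "0 \<le> qform (clamped_inv_pow m r X) v"
    unfolding diagonalizes_qform[OF Z v] by (intro sum_nonneg) auto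
  have "max (d i) m powr (- r) \<le> m powr (- r)" for i
    using m r by (intro powr_mono2') auto
  then show "qform (clamped_inv_pow m r X) v \<le> m powr (- r) * (vnorm v)\<^sup>2"
    using diagonalizes_qform_le_iff[OF Z, of "m powr (- r)"] v by blast
qed

lemma clamped_inv_pow_lipschitz:
  assumes X: "hermitian_mat n X" and Y: "hermitian_mat n Y" and m: "0 < m" and r: "0 \<le> r"
  shows "frob_norm (clamped_inv_pow m r X - clamped_inv_pow m r Y) \<le> r / m powr (r + 1) * frob_norm (X - Y)"
proof -
  obtain U d where D: "diagonalizes n U d X" using hermitian_spectral[OF X] by blast
  obtain V e where E: "diagonalizes n V e Y" using hermitian_spectral[OF Y] by blast
  note Z = diagonalizes_matfun[where f = "\<lambda>x. max x m powr (- r)", folded clamped_inv_pow_def]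
  have "\<bar>max x m powr (- r) - max y m powr (- r)\<bar> \<le> r / m powr (r + 1) * \<bar>x - y\<bar>" for x y
  proof -
    have "\<bar>max x m powr (- r) - max y m powr (- r)\<bar> \<le> \<bar>- r\<bar> * m powr (- r - 1) * \<bar>max x m - max y m\<bar>"
      using m r by (intro abs_powr_diff_le) auto
    also have "\<dots> \<le> \<bar>- r\<bar> * m powr (- r - 1) * \<bar>x - y\<bar>"
      by (intro mult_left_mono) auto
    also have "\<bar>- r\<bar> * m powr (- r - 1) = r / m powr (r + 1)"
      using r powr_minus_divide[of m "r + 1"] by simp
    finally show ?thesis .
  qed
  then have "frob_sq (clamped_inv_pow m r X - clamped_inv_pow m r Y) \<le> (r / m powr (r + 1))\<^sup>2 * frob_sq (X - Y)"
    by (intro frob_sq_diff_mono[OF D E Z[OF D] Z[OF E]])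
  then show ?thesis using r by (subst frob_norm_le_iff) auto
qed

text \<open>The equation encodes X^(-r) as \<open>mpow (minv X) r\<close>. On a spectrum above
  \<open>m\<close> the maximum is idle, and (1/d)^r = d^(-r).\<close>

lemma mpow_minv_eq_clamped:
  assumes X: "diagonalizes n U d X" and d: "\<And>i. i < n \<Longrightarrow> m \<le> d i" and m: "0 < m"
  shows "mpow (minv X) r = clamped_inv_pow m r X"
proof -
  have d0: "d i > 0" if "i < n" for i using d[OF that] m by linarith
  have "diagonalizes n U (\<lambda>i. 1 / d i) (minv X)"
    using d0 by (intro diagonalizes_minv[OF X]) force
  then have "diagonalizes n U (\<lambda>i. (1 / d i) powr r) (mpow (minv X) r)"
    using d0 by (intro diagonalizes_mpow) auto
  then have "diagonalizes n U (\<lambda>i. max (d i) m powr (- r)) (mpow (minv X) r)"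
    using d d0 by (rule_tac diagonalizes_cong) (auto simp: max_absorb1 powr_divide powr_minus_divide less_imp_le)
  then show ?thesis
    unfolding clamped_inv_pow_def
    by (rule diagonalizes_eq[OF _ diagonalizes_matfun[OF X, where f = "\<lambda>x. max x m powr (- r)"]])
qed

text \<open>Existence and uniqueness depend on k and c1 only through \<open>m\<close>, the product
  of the two. The assumption \<open>dom\<close> is the domination inequality written with quadratic
  forms.\<close>

locale dominated_equation =
  fixes n :: nat and A B Q :: "complex mat" and s t p m :: real
  assumes s: "s \<ge> 1" and t: "t \<ge> 0" and p: "p \<ge> 0" and m: "m > 0"
    and A [simp]: "A \<in> carrier_mat n n" and B [simp]: "B \<in> carrier_mat n n" and Q: "pd_mat n Q"
    and dom: "\<And>v. v \<in> carrier_vec n \<Longrightarrow> m powr s * (vnorm v)\<^sup>2 + m powr (- t) * (vnorm (A *\<^sub>v v))\<^sup>2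
      + m powr (- p) * (vnorm (B *\<^sub>v v))\<^sup>2 \<le> qform Q v"
begin

definition residual :: "complex mat \<Rightarrow> complex mat" where
  "residual X = Q - mat_adjoint A * clamped_inv_pow m t X * A - mat_adjoint B * clamped_inv_pow m p X * B"

lemma Qh: "hermitian_mat n Q"
  using Q by (simp add: pd_mat_def)

lemma Qc [simp]: "Q \<in> carrier_mat n n"
  using Qh by (simp add: hermitian_mat_def)

lemma clamped_carrier [simp]: "hermitian_mat n X \<Longrightarrow> clamped_inv_pow m r X \<in> carrier_mat n n"
  using clamped_inv_pow_hermitian by (simp add: hermitian_mat_def)

lemma residual_hermitian: "hermitian_mat n X \<Longrightarrow> hermitian_mat n (residual X)"
  unfolding residual_def
  by (intro hermitian_minus hermitian_congruence clamped_inv_pow_hermitian Qh A B)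

text \<open>The clamped powers lie between 0 and m^(-t) I, respectively m^(-p) I, so domination
  leaves at least m^s I, and at most \<open>Q\<close> remains.\<close>

lemma residual_qform:
  assumes X: "hermitian_mat n X" and v: "v \<in> carrier_vec n"
  shows "m powr s * (vnorm v)\<^sup>2 \<le> qform (residual X) v" and "qform (residual X) v \<le> qform Q v"
proof -
  have eq: "qform (residual X) v = qform Q v - qform (clamped_inv_pow m t X) (A *\<^sub>v v)
      - qform (clamped_inv_pow m p X) (B *\<^sub>v v)"
    unfolding residual_def using X v
    by (simp add: qform_minus[of _ n] qform_congruence[of _ n] minus_carrier_mat)
  have Av: "A *\<^sub>v v \<in> carrier_vec n" and Bv: "B *\<^sub>v v \<in> carrier_vec n" using v by auto
  show "m powr s * (vnorm v)\<^sup>2 \<le> qform (residual X) v" "qform (residual X) v \<le> qform Q v"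
    using dom[OF v] clamped_inv_pow_qform[OF X m t Av] clamped_inv_pow_qform[OF X m p Bv]
    unfolding eq by linarith+
qed

text \<open>\<open>Q\<close> cancels in the difference, leaving congruences by \<open>A\<close> and
  \<open>B\<close> of differences of clamped powers. The subtraction reverses the order, hence
  \<open>Y - X\<close> on the right.\<close>

lemma residual_lipschitz:
  assumes X: "hermitian_mat n X" and Y: "hermitian_mat n Y"
  shows "frob_norm (residual X - residual Y)
    \<le> (t / m powr (t + 1) * (spec_norm A)\<^sup>2 + p / m powr (p + 1) * (spec_norm B)\<^sup>2) * frob_norm (Y - X)"
proof -
  define DA where "DA = clamped_inv_pow m t Y - clamped_inv_pow m t X"
  define DB where "DB = clamped_inv_pow m p Y - clamped_inv_pow m p X"
  have c [simp]: "DA \<in> carrier_mat n n" "DB \<in> carrier_mat n n"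
    using X Y by (auto simp: DA_def DB_def intro!: minus_carrier_mat)
  have *: "(Q - M - N) - (Q - M' - N') = (M' - M) + (N' - N)"
    if "M \<in> carrier_mat n n" "N \<in> carrier_mat n n" "M' \<in> carrier_mat n n" "N' \<in> carrier_mat n n"
    for M N M' N' :: "complex mat"
    using that Qc by (intro eq_matI) auto
  have "residual X - residual Y = mat_adjoint A * DA * A + mat_adjoint B * DB * B"
    unfolding residual_def DA_def DB_def using X Y
    by (subst *) (auto simp: mult_minus_distrib_mat[of _ n n _ n] minus_mult_distrib_mat[of _ n n _ _ n])
  then have "frob_norm (residual X - residual Y)
      \<le> frob_norm (mat_adjoint A * DA * A) + frob_norm (mat_adjoint B * DB * B)"
    using frob_norm_triangle[of "mat_adjoint A * DA * A" n n "mat_adjoint B * DB * B"] by simp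
  also have "\<dots> \<le> (spec_norm A)\<^sup>2 * frob_norm DA + (spec_norm B)\<^sup>2 * frob_norm DB"
    by (intro add_mono frob_norm_congruence_le[of _ n]) auto
  also have "\<dots> \<le> (spec_norm A)\<^sup>2 * (t / m powr (t + 1) * frob_norm (Y - X))
      + (spec_norm B)\<^sup>2 * (p / m powr (p + 1) * frob_norm (Y - X))"
    unfolding DA_def DB_def
    by (intro add_mono mult_left_mono clamped_inv_pow_lipschitz[OF Y X m]) (auto intro: t p)
  finally show ?thesis by (simp add: algebra_simps)
qed

text \<open>Above m I the clamping is vacuous, so the equation becomes the fixed point form treated
  by the estimates.\<close>

lemma solution_iff_residual:
  assumes X: "hermitian_mat n X" and ge: "\<And>v. v \<in> carrier_vec n \<Longrightarrow> m * (vnorm v)\<^sup>2 \<le> qform X v"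
  shows "mpow X s + mat_adjoint A * mpow (minv X) t * A + mat_adjoint B * mpow (minv X) p * B = Q
    \<longleftrightarrow> mpow X s = residual X"
proof -
  obtain U d where D: "diagonalizes n U d X" using hermitian_spectral[OF X] by blast
  have d: "m \<le> d i" if "i < n" for i
    using diagonalizes_qform_ge_iff[OF D, of m] ge that by blast
  have "d i > 0" if "i < n" for i using d[OF that] m by linarith
  then have "mpow X s \<in> carrier_mat n n"
    using diagonalizes_carrier diagonalizes_mpow[OF D] by blast
  moreover have clamp: "mpow (minv X) r = clamped_inv_pow m r X" for r
    by (rule mpow_minv_eq_clamped[OF D _ m]) (rule d)
  ultimately show ?thesis
    unfolding residual_def clamp using X by (intro mat_add_add_eq_iff[of _ n]) auto
qed

lemma residual_diagonalizes:
  assumes X: "hermitian_mat n X"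
  obtains W e where "diagonalizes n W e (residual X)" "\<And>i. i < n \<Longrightarrow> m powr s \<le> e i"
proof -
  obtain W e where E: "diagonalizes n W e (residual X)"
    using hermitian_spectral[OF residual_hermitian[OF X]] by blast
  then have "\<forall>i<n. m powr s \<le> e i"
    using diagonalizes_qform_ge_iff[OF E, of "m powr s"] residual_qform(1)[OF X] by blast
  then show ?thesis using that E by blast
qed

lemma powr_root_ge: "m powr s \<le> x \<Longrightarrow> m \<le> x powr (1 / s)"
proof -
  assume "m powr s \<le> x"
  then have "(m powr s) powr (1 / s) \<le> x powr (1 / s)"
    using s by (intro powr_mono2) auto
  then show ?thesis using s m by (simp add: powr_powr)
qed

text \<open>The root is clamped at m^s as well. The spectrum of the residual already lies above m^s,
  so no value changes, but the scalar function becomes Lipschitz on the whole line.\<close>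

lemma exists_fixed_point:
  "\<exists>X. hermitian_mat n X \<and> matfun (\<lambda>x. max x (m powr s) powr (1 / s)) (residual X) = X"
proof -
  let ?g = "\<lambda>x. max x (m powr s) powr (1 / s)"
  obtain V q where q: "diagonalizes n V q Q" using hermitian_spectral[OF Qh] by blast
  \<comment> \<open>Bounds the spectrum of \<open>Q\<close>, hence that of every residual. Inserting
    m^s keeps the set nonempty and ensures m^s \<le> \<open>b\<close>.\<close>
  define b where "b = Max (insert (m powr s) (q ` {..<n}))"
  have b: "m powr s \<le> b" "\<And>i. i < n \<Longrightarrow> q i \<le> b" by (auto simp: b_def)
  \<comment> \<open>The slope of x^(1/s) at the clamping point m^s.\<close>
  define L1 where "L1 = \<bar>1 / s\<bar> * (m powr s) powr (1 / s - 1)"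
  define L2 where "L2 = t / m powr (t + 1) * (spec_norm A)\<^sup>2 + p / m powr (p + 1) * (spec_norm B)\<^sup>2"
  have L1: "L1 \<ge> 0" by (simp add: L1_def)
  have ms: "m powr s > 0" using m by simp
  show ?thesis
  proof (rule hermitian_fixed_point)
    fix X assume X: "hermitian_mat n X"
    obtain W e where E: "diagonalizes n W e (residual X)" and e: "\<And>i. i < n \<Longrightarrow> m powr s \<le> e i"
      using residual_diagonalizes[OF X] by blast
    note G = diagonalizes_matfun[OF E, of ?g]
    show "hermitian_mat n (matfun ?g (residual X))" by (rule diagonalizes_hermitian[OF G])
    have "qform Q v \<le> b * (vnorm v)\<^sup>2" if "v \<in> carrier_vec n" for v
      using diagonalizes_qform_le_iff[OF q, of b] b(2) that by blast
    then have "qform (residual X) v \<le> b * (vnorm v)\<^sup>2" if "v \<in> carrier_vec n" for v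
      using residual_qform(2)[OF X that] that by force
    then have eb: "e i \<le> b" if "i < n" for i
      using diagonalizes_qform_le_iff[OF E, of b] that by blast
    have "(?g (e i))\<^sup>2 \<le> (b powr (1 / s))\<^sup>2" if "i < n" for i
      using eb[OF that] b(1) ms s by (intro power_mono powr_mono2) (auto simp: le_max_iff_disj)
    then have "frob_sq (matfun ?g (residual X)) \<le> (\<Sum>i<n. (b powr (1 / s))\<^sup>2)"
      unfolding frob_sq_diagonalized[OF G] by (intro sum_mono) auto
    then show "frob_norm (matfun ?g (residual X)) \<le> sqrt (\<Sum>i<n. (b powr (1 / s))\<^sup>2)"
      unfolding frob_norm_def by (rule real_sqrt_le_mono)
    fix Y assume Y: "hermitian_mat n Y"
    obtain W' e' where E': "diagonalizes n W' e' (residual Y)"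
      using hermitian_spectral[OF residual_hermitian[OF Y]] by blast
    have "\<bar>?g x - ?g y\<bar> \<le> L1 * \<bar>x - y\<bar>" for x y
    proof -
      have "\<bar>?g x - ?g y\<bar> \<le> L1 * \<bar>max x (m powr s) - max y (m powr s)\<bar>"
        unfolding L1_def using ms s by (intro abs_powr_diff_le) auto
      also have "\<dots> \<le> L1 * \<bar>x - y\<bar>" using L1 by (intro mult_left_mono) auto
      finally show ?thesis .
    qed
    then have "frob_sq (matfun ?g (residual X) - matfun ?g (residual Y)) \<le> L1\<^sup>2 * frob_sq (residual X - residual Y)"
      by (intro frob_sq_diff_mono[OF E E' G diagonalizes_matfun[OF E']])
    then have "frob_norm (matfun ?g (residual X) - matfun ?g (residual Y)) \<le> L1 * frob_norm (residual X - residual Y)"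
      using L1 by (subst frob_norm_le_iff) auto
    also have "\<dots> \<le> L1 * (L2 * frob_norm (Y - X))"
      unfolding L2_def using L1 residual_lipschitz[OF X Y] by (intro mult_left_mono) auto
    also have "frob_norm (Y - X) = frob_norm (X - Y)"
      using X Y unfolding frob_norm_def frob_sq_def hermitian_mat_def by (auto simp: norm_minus_commute)
    finally show "frob_norm (matfun ?g (residual X) - matfun ?g (residual Y)) \<le> (L1 * L2) * frob_norm (X - Y)"
      by (simp add: mult.assoc)
  qed
qed

text \<open>Dropping the two nonnegative terms of the domination leaves m^s I \<le>
  \<open>Q\<close>; this bounds the eigenvalues of \<open>Q\<close>, and scalar roots are
  monotone.\<close>

lemma scalar_le_root:
  "loewner_le n (complex_of_real m \<cdot>\<^sub>m 1\<^sub>m n) (mpow Q (1 / s))"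
proof -
  obtain V q where q: "diagonalizes n V q Q" and q0: "\<And>i. i < n \<Longrightarrow> q i > 0"
    using pd_mat_diagonalizes[OF Q] by blast
  have "m powr s * (vnorm v)\<^sup>2 \<le> qform Q v" if "v \<in> carrier_vec n" for v
    using dom[OF that] by (smt (verit) powr_ge_zero mult_nonneg_nonneg zero_le_power2)
  then have "m powr s \<le> q i" if "i < n" for i
    using diagonalizes_qform_ge_iff[OF q, of "m powr s"] that by blast
  then have "\<forall>i<n. m \<le> q i powr (1 / s)" using powr_root_ge by blast
  note D = diagonalizes_mpow[OF q q0, of "1 / s"]
  have "m * (vnorm v)\<^sup>2 \<le> qform (mpow Q (1 / s)) v" if "v \<in> carrier_vec n" for v
    using diagonalizes_qform_ge_iff[OF D, of m] \<open>\<forall>i<n. m \<le> q i powr (1 / s)\<close> that by blast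
  then show ?thesis
    by (simp add: loewner_le_iff hermitian_scalar diagonalizes_hermitian[OF D] qform_scalar)
qed

lemma exists_solution:
  "\<exists>X \<in> loewner_interval n (complex_of_real m \<cdot>\<^sub>m 1\<^sub>m n) (mpow Q (1 / s)). pd_mat n X \<and>
     mpow X s + mat_adjoint A * mpow (minv X) t * A + mat_adjoint B * mpow (minv X) p * B = Q"
proof -
  let ?g = "\<lambda>x. max x (m powr s) powr (1 / s)"
  have ms: "m powr s > 0" using m by simp
  obtain X where X: "hermitian_mat n X" and fix_X: "matfun ?g (residual X) = X"
    using exists_fixed_point by blast
  obtain W e where E: "diagonalizes n W e (residual X)" and e: "\<And>i. i < n \<Longrightarrow> m powr s \<le> e i"
    using residual_diagonalizes[OF X] by blast
  have e0: "e i > 0" if "i < n" for i using e[OF that] ms by linarith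
  \<comment> \<open>The clamp of the root is idle on the spectrum of the residual, so
    \<open>X\<close> is its genuine s-th root.\<close>
  have D: "diagonalizes n W (\<lambda>i. e i powr (1 / s)) X"
    using diagonalizes_cong[OF diagonalizes_matfun[OF E, of ?g], of "\<lambda>i. e i powr (1 / s)"] e
    by (simp add: fix_X max_absorb1)
  have "\<forall>i<n. m \<le> e i powr (1 / s)" using e powr_root_ge by blast
  then have ge: "m * (vnorm v)\<^sup>2 \<le> qform X v" if "v \<in> carrier_vec n" for v
    using diagonalizes_qform_ge_iff[OF D, of m] that by blast
  have pd: "pd_mat n X" using pd_matI_qform_ge[OF X m ge] .
  have "diagonalizes n W (\<lambda>i. (e i powr (1 / s)) powr s) (mpow X s)"
    using e0 by (intro diagonalizes_mpow[OF D]) force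
  then have "diagonalizes n W e (mpow X s)"
    by (rule diagonalizes_cong) (use s e0 in \<open>simp add: powr_powr less_imp_le\<close>)
  then have "mpow X s = residual X" using diagonalizes_eq E by blast
  then have sol: "mpow X s + mat_adjoint A * mpow (minv X) t * A + mat_adjoint B * mpow (minv X) p * B = Q"
    using solution_iff_residual[OF X ge] by blast
  obtain V q where q: "diagonalizes n V q Q" and q0: "\<And>i. i < n \<Longrightarrow> q i > 0"
    using pd_mat_diagonalizes[OF Q] by blast
  note PQ = positive_powers_mpow[OF q q0] and PR = positive_powers_mpow[OF E e0]
  have P1: "mpow Q 1 = Q"
    using diagonalizes_eq[OF diagonalizes_cong[OF diagonalizes_mpow[OF q q0, of 1]] q] q0
    by (simp add: less_imp_le)
  have R1: "mpow (residual X) 1 = residual X"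
    using diagonalizes_eq[OF diagonalizes_cong[OF diagonalizes_mpow[OF E e0, of 1]] E] e0
    by (simp add: less_imp_le)
  have Rs: "mpow (residual X) (1 / s) = X"
    using diagonalizes_eq[OF diagonalizes_mpow[OF E e0] D] .
  \<comment> \<open>The residual is below \<open>Q\<close>, and taking s-th roots preserves this by
    Loewner-Heinz with exponent 1/s in [0, 1].\<close>
  have "qform X v \<le> qform (mpow Q (1 / s)) v" if "v \<in> carrier_vec n" for v
    using loewner_heinz[OF PQ PR, of "1 / s" v] residual_qform(2)[OF X] s that
    by (simp add: P1 R1 Rs)
  then have "X \<in> loewner_interval n (complex_of_real m \<cdot>\<^sub>m 1\<^sub>m n) (mpow Q (1 / s))"
    using X ge diagonalizes_hermitian[OF diagonalizes_mpow[OF q q0]]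
    by (simp add: loewner_interval_def loewner_le_iff hermitian_scalar qform_scalar)
  then show ?thesis using pd sol by blast
qed

text \<open>With c = s m^(s-1) and \<open>L\<close> the Lipschitz constant of
  \<open>residual\<close>, c times the distance of two solutions is at most the distance of their
  s-th powers, which are their residuals, hence at most \<open>L\<close> times the original
  distance. The hypothesis says L/c < 1.\<close>

lemma solution_unique:
  assumes contr: "(1 / s) * m powr (1 - s) *
      (t / m powr (t + 1) * (spec_norm A)\<^sup>2 + p / m powr (p + 1) * (spec_norm B)\<^sup>2) < 1"
    and XY: "loewner_le n (complex_of_real m \<cdot>\<^sub>m 1\<^sub>m n) X" "loewner_le n (complex_of_real m \<cdot>\<^sub>m 1\<^sub>m n) Y"
    and sol: "mpow X s + mat_adjoint A * mpow (minv X) t * A + mat_adjoint B * mpow (minv X) p * B = Q"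
      "mpow Y s + mat_adjoint A * mpow (minv Y) t * A + mat_adjoint B * mpow (minv Y) p * B = Q"
  shows "Y = X"
proof -
  define L where "L = t / m powr (t + 1) * (spec_norm A)\<^sup>2 + p / m powr (p + 1) * (spec_norm B)\<^sup>2"
  have X: "hermitian_mat n X" and geX: "\<And>v. v \<in> carrier_vec n \<Longrightarrow> m * (vnorm v)\<^sup>2 \<le> qform X v"
    and Y: "hermitian_mat n Y" and geY: "\<And>v. v \<in> carrier_vec n \<Longrightarrow> m * (vnorm v)\<^sup>2 \<le> qform Y v"
    using XY by (auto simp: loewner_le_iff qform_scalar)
  have res: "mpow X s = residual X" "mpow Y s = residual Y"
    using sol solution_iff_residual[OF X geX] solution_iff_residual[OF Y geY] by blast+
  obtain U d where D: "diagonalizes n U d X" using hermitian_spectral[OF X] by blast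
  obtain V e where E: "diagonalizes n V e Y" using hermitian_spectral[OF Y] by blast
  have d: "m \<le> d i" if "i < n" for i
    using diagonalizes_qform_ge_iff[OF D, of m] geX that by blast
  have e: "m \<le> e i" if "i < n" for i
    using diagonalizes_qform_ge_iff[OF E, of m] geY that by blast
  have pos: "\<And>i. i < n \<Longrightarrow> d i > 0" "\<And>i. i < n \<Longrightarrow> e i > 0"
    using d e m by force+
  define c where "c = s * m powr (s - 1)"
  have c: "c > 0" using s m by (simp add: c_def)
  have "\<bar>e i - d j\<bar> \<le> 1 / c * \<bar>e i powr s - d j powr s\<bar>" if "i < n" "j < n" for i j
    using abs_powr_diff_ge[OF m e[OF that(1)] d[OF that(2)] s] c by (simp add: c_def field_simps)
  \<comment> \<open>The comparison is read backwards: the s-th powers are the arguments, and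
    \<open>X\<close> and \<open>Y\<close> appear as their images.\<close>
  then have "frob_sq (Y - X) \<le> (1 / c)\<^sup>2 * frob_sq (mpow Y s - mpow X s)"
    by (intro frob_sq_diff_mono[OF diagonalizes_mpow[OF E pos(2)] diagonalizes_mpow[OF D pos(1)] E D])
  then have "frob_norm (Y - X) \<le> 1 / c * frob_norm (mpow Y s - mpow X s)"
    using c by (subst frob_norm_le_iff) auto
  also have "\<dots> \<le> 1 / c * (L * frob_norm (X - Y))"
    unfolding res L_def using c residual_lipschitz[OF Y X] by (intro mult_left_mono) auto
  also have "frob_norm (X - Y) = frob_norm (Y - X)"
    using X Y unfolding frob_norm_def frob_sq_def hermitian_mat_def by (auto simp: norm_minus_commute)
  finally have le: "frob_norm (Y - X) \<le> (1 / c * L) * frob_norm (Y - X)" by simp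
  have "1 / c = 1 / s * m powr (1 - s)"
    using s powr_minus_divide[of m "s - 1"] by (simp add: c_def)
  then have lt: "1 / c * L < 1" using contr by (simp only: L_def)
  have "frob_norm (Y - X) = 0"
  proof (rule ccontr)
    assume "frob_norm (Y - X) \<noteq> 0"
    then have "frob_norm (Y - X) > 0" using frob_norm_nonneg[of "Y - X"] by linarith
    then have "(1 / c * L) * frob_norm (Y - X) < 1 * frob_norm (Y - X)"
      using lt by (intro mult_strict_right_mono)
    then show False using le by linarith
  qed
  then show ?thesis
    using frob_sq_minus_eq_0[of Y n n X] X Y by (simp add: frob_norm_def hermitian_mat_def)
qed

end

section \<open>From the hypotheses of the theorem to domination\<close>

text \<open>Through this fact nonsingularity makes A Q^(-1) A* definite, and so c1 positive.\<close>

lemma GL_adjoint_injective: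
  assumes A: "A \<in> GL n" and w: "w \<in> carrier_vec n" and z: "mat_adjoint A *\<^sub>v w = 0\<^sub>v n"
  shows "w = 0\<^sub>v n"
proof -
  have Ac: "A \<in> carrier_mat n n" using A by (simp add: GL_def)
  obtain B where B: "A * B = 1\<^sub>m n" "B * A = 1\<^sub>m (dim_row B)"
    using A Ac by (auto simp: GL_def invertible_mat_def inverts_mat_def)
  have "dim_col B = n" using arg_cong[OF B(1), of dim_col] by simp
  moreover have "dim_row B = n" using arg_cong[OF B(2), of dim_col] Ac by simp
  ultimately have Bc: "B \<in> carrier_mat n n" by auto
  have "mat_adjoint B * mat_adjoint A = 1\<^sub>m n"
    using mat_adjoint_mult[OF Ac Bc] B(1) by simp
  then have "w = (mat_adjoint B * mat_adjoint A) *\<^sub>v w" using w by simp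
  also have "\<dots> = mat_adjoint B *\<^sub>v 0\<^sub>v n"
    using Ac Bc w z by (simp add: assoc_mult_mat_vec[of _ n n _ n])
  also have "\<dots> = 0\<^sub>v n" using Bc by (intro eq_vecI) (auto simp: scalar_prod_def)
  finally show ?thesis .
qed

text \<open>Positivity follows by testing A Q^(-1) A* on its eigenvector \<open>col U 0\<close>,
  available because \<open>n\<close> is positive. The second claim takes the top eigenvalue as the
  constant in the passage from A Q^(-1) A* to A*A.\<close>

lemma lambda1_congruence_inverse:
  assumes n: "0 < n" and A: "A \<in> GL n" and Q: "pd_mat n Q"
  shows "0 < lambda1 (A * minv Q * mat_adjoint A)"
    and "v \<in> carrier_vec n \<Longrightarrow> (vnorm (A *\<^sub>v v))\<^sup>2 \<le> lambda1 (A * minv Q * mat_adjoint A) * qform Q v"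
proof -
  have Ac: "A \<in> carrier_mat n n" using A by (simp add: GL_def)
  obtain V q where q: "diagonalizes n V q Q" and q0: "\<And>i. i < n \<Longrightarrow> q i > 0"
    using pd_mat_diagonalizes[OF Q] by blast
  have I: "diagonalizes n V (\<lambda>i. 1 / q i) (minv Q)"
    using q0 by (intro diagonalizes_minv[OF q]) force
  note Ic = diagonalizes_carrier[OF I]
  define M where "M = A * minv Q * mat_adjoint A"
  have qM: "qform M w = qform (minv Q) (mat_adjoint A *\<^sub>v w)" if "w \<in> carrier_vec n" for w
    using qform_congruence[of "mat_adjoint A" n "minv Q" w] Ac Ic that by (simp add: M_def)
  have "hermitian_mat n M"
    using hermitian_congruence[OF diagonalizes_hermitian[OF I], of "mat_adjoint A"] Ac by (simp add: M_def)
  then obtain U f where f: "diagonalizes n U f M" using hermitian_spectral by blast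
  have "f 0 > 0"
  proof -
    define w where "w = mat_adjoint A *\<^sub>v col U 0"
    have u: "col U 0 \<in> carrier_vec n" "vnorm (col U 0) = 1"
      using diagonalizes_eigenvector[OF f n] by auto
    then have w: "w \<in> carrier_vec n" using Ac by (simp add: w_def)
    have "col U 0 \<noteq> 0\<^sub>v n" using u vnorm_eq_0_iff[OF u(1)] by auto
    then have w0: "w \<noteq> 0\<^sub>v n" using GL_adjoint_injective[OF A u(1)] unfolding w_def by blast
    interpret P: positive_powers n V q "mpow Q" by (rule positive_powers_mpow[OF q q0])
    have "mpow Q (- 1) = minv Q"
      using diagonalizes_eq[OF P.diag[of "- 1"] diagonalizes_cong[OF I]] q0
      by (simp add: powr_minus_divide less_imp_le)
    then have "qform (minv Q) w = (vnorm (mpow Q (- 1 / 2) *\<^sub>v w))\<^sup>2"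
      using P.qform_power[OF w, of "- 1"] by simp
    moreover have "vnorm (mpow Q (- 1 / 2) *\<^sub>v w) \<noteq> 0"
      using P.power_vec_eq_0[OF w] w0 vnorm_eq_0_iff[of "mpow Q (- 1 / 2) *\<^sub>v w" n] w by auto
    ultimately have "qform (minv Q) w > 0" by simp
    then show ?thesis
      using diagonalizes_qform_col[OF f n] qM[OF u(1)] by (simp add: w_def)
  qed
  then show pos: "0 < lambda1 (A * minv Q * mat_adjoint A)"
    using diagonalizes_le_lambda1[OF f n] by (simp add: M_def)
  have "qform M w \<le> lambda1 M * (vnorm w)\<^sup>2" if "w \<in> carrier_vec n" for w
    using diagonalizes_qform_le_iff[OF f, of "lambda1 M"] diagonalizes_le_lambda1[OF f] that by blast
  then show "v \<in> carrier_vec n \<Longrightarrow> (vnorm (A *\<^sub>v v))\<^sup>2 \<le> lambda1 (A * minv Q * mat_adjoint A) * qform Q v"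
    using pos unfolding M_def by (intro vnorm_mult_sq_le_of_inverse_bound[OF Ac q q0]) auto
qed

text \<open>The eigenvalues of c Q^(-1) are c/q_i for q_i those of \<open>Q\<close>; bounding them
  all by \<open>l\<close> means q_i \<ge> c/l.\<close>

lemma qform_ge_of_lambda1_minv:
  assumes Q: "pd_mat n Q" and c: "0 < c" and l: "0 < l"
    and le: "lambda1 (complex_of_real c \<cdot>\<^sub>m minv Q) \<le> l" and v: "v \<in> carrier_vec n"
  shows "c * (vnorm v)\<^sup>2 \<le> l * qform Q v"
proof -
  obtain V q where q: "diagonalizes n V q Q" and q0: "\<And>i. i < n \<Longrightarrow> q i > 0"
    using pd_mat_diagonalizes[OF Q] by blast
  have I: "diagonalizes n V (\<lambda>i. 1 / q i) (minv Q)"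
    using q0 by (intro diagonalizes_minv[OF q]) force
  have "\<forall>i<n. c / l \<le> q i"
  proof (intro allI impI)
    fix i assume i: "i < n"
    have "c * (1 / q i) \<le> l"
      using diagonalizes_le_lambda1[OF diagonalizes_smult[OF I, of c] i] le by simp
    then show "c / l \<le> q i" using q0[OF i] l by (simp add: field_simps)
  qed
  then have "c / l * (vnorm v)\<^sup>2 \<le> qform Q v"
    using diagonalizes_qform_ge_iff[OF q, of "c / l"] v by blast
  then show ?thesis using l by (simp add: field_simps)
qed

text \<open>Explains the exponents in c1: \<open>L powr (1 / r)\<close> \<le> \<open>c\<close> gives
  \<open>L\<close> \<le> c^r, which cancels c^(-r) and leaves a share k^(-r).\<close>

lemma powr_neg_mult_le:
  fixes k c r L N q :: real
  assumes "0 < k" "0 < c" "1 \<le> r" "0 \<le> L" "L powr (1 / r) \<le> c" "N \<le> L * q" "0 \<le> q"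
  shows "(k * c) powr (- r) * N \<le> k powr (- r) * q"
proof -
  have "L = (L powr (1 / r)) powr r" using assms by (simp add: powr_powr)
  also have "\<dots> \<le> c powr r" using assms by (intro powr_mono2) auto
  finally have "L * q \<le> c powr r * q" using assms by (intro mult_right_mono)
  then have "(k * c) powr (- r) * N \<le> (k * c) powr (- r) * (c powr r * q)"
    using assms by (intro mult_left_mono) auto
  also have "\<dots> = k powr (- r) * (c powr (- r) * c powr r) * q"
    using assms by (simp add: powr_mult mult_ac)
  also have "c powr (- r) * c powr r = 1" using assms by (simp flip: powr_add)
  finally show ?thesis by simp
qed

theorem mainTheorem10:
  fixes n :: nat and s t p k :: real and A B Q :: "complex mat"
  assumes "s \<ge> 1" and "t \<ge> 1" and "p \<ge> 1"
    and "A \<in> GL n" and "B \<in> GL n" and "pd_mat n Q"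
    and "k > 0" and "k powr (-t) + k powr (-p) < 1"
    and "lambda1 (complex_of_real
            (max (lambda1 (A * minv Q * mat_adjoint A) powr (1/t))
                 (lambda1 (B * minv Q * mat_adjoint B) powr (1/p)) powr s) \<cdot>\<^sub>m minv Q)
         \<le> (1 - k powr (-t) - k powr (-p)) * k powr (-s)"
  shows "let c1 = max (lambda1 (A * minv Q * mat_adjoint A) powr (1/t))
                      (lambda1 (B * minv Q * mat_adjoint B) powr (1/p));
             I = loewner_interval n (complex_of_real (k * c1) \<cdot>\<^sub>m 1\<^sub>m n) (mpow Q (1/s));
             sol = (\<lambda>X. mpow X s + mat_adjoint A * mpow (minv X) t * A
                          + mat_adjoint B * mpow (minv X) p * B = Q)
         in loewner_le n (complex_of_real (k * c1) \<cdot>\<^sub>m 1\<^sub>m n) (mpow Q (1/s)) \<and>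
            (\<exists>X \<in> I. pd_mat n X \<and> sol X \<and>
               ((1/s) * (k * c1) powr (1 - s) *
                  (t / (k * c1) powr (t + 1) * (spec_norm A)\<^sup>2
                   + p / (k * c1) powr (p + 1) * (spec_norm B)\<^sup>2) < 1
                \<longrightarrow> (\<forall>Y \<in> I. sol Y \<longrightarrow> Y = X)))"
proof -
  define c where "c = max (lambda1 (A * minv Q * mat_adjoint A) powr (1/t))
                      (lambda1 (B * minv Q * mat_adjoint B) powr (1/p))"
  have Ac: "A \<in> carrier_mat n n" and Bc: "B \<in> carrier_mat n n"
    using assms(4,5) by (auto simp: GL_def)
  obtain V q where q: "diagonalizes n V q Q" and q0: "\<And>i. i < n \<Longrightarrow> q i > 0"
    using pd_mat_diagonalizes[OF assms(6)] by blast
  show ?thesis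
  \<comment> \<open>A matrix of size 0 has no eigenvalues, so \<open>lambda1\<close> is an
    unspecified \<open>Max {}\<close> and positivity of \<open>c\<close> cannot be derived. All
    matrices of that size coincide, and \<open>Q\<close> itself is the solution.\<close>
  proof (cases "n = 0")
    case True
    have eq0: "M = N" if "dim_row M = 0" "dim_col M = 0" "dim_row N = 0" "dim_col N = 0" for M N :: "complex mat"
      using that by (intro eq_matI) auto
    have herm0: "hermitian_mat 0 M" if "dim_row M = 0" "dim_col M = 0" for M
      using that by (auto simp: hermitian_mat_def intro!: eq0)
    have qf0: "qform M v = 0" if "v \<in> carrier_vec 0" for M v
      using that by (simp add: qform_def scalar_prod_def)
    have Q0: "dim_row Q = 0" "dim_col Q = 0" "dim_row (mpow Q (1/s)) = 0" "dim_col (mpow Q (1/s)) = 0"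
      using diagonalizes_carrier[OF q] diagonalizes_carrier[OF diagonalizes_mpow[OF q q0, of "1/s"]] True by auto
    have A0: "dim_col A = 0" "dim_col B = 0" using Ac Bc True by auto
    have "loewner_le 0 (complex_of_real (k * c) \<cdot>\<^sub>m 1\<^sub>m 0) (mpow Q (1/s))"
      using Q0 by (simp add: loewner_le_iff hermitian_scalar herm0 qf0)
    moreover have "Q \<in> loewner_interval 0 (complex_of_real (k * c) \<cdot>\<^sub>m 1\<^sub>m 0) (mpow Q (1/s))"
      using Q0 by (simp add: loewner_interval_def loewner_le_iff hermitian_scalar herm0 qf0)
    moreover have "mpow Q s + mat_adjoint A * mpow (minv Q) t * A + mat_adjoint B * mpow (minv Q) p * B = Q"
      using Q0 A0 by (intro eq0) auto
    moreover have "Y = Q" if "Y \<in> loewner_interval 0 (complex_of_real (k * c) \<cdot>\<^sub>m 1\<^sub>m 0) (mpow Q (1/s))" for Y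
      using that Q0 by (intro eq0) (auto simp: loewner_interval_def hermitian_mat_def)
    ultimately show ?thesis
      using assms(6) unfolding Let_def c_def[symmetric] True by blast
  next
    case False
    then have n: "0 < n" by simp
    note LA = lambda1_congruence_inverse[OF n assms(4,6)]
    note LB = lambda1_congruence_inverse[OF n assms(5,6)]
    have cA: "lambda1 (A * minv Q * mat_adjoint A) powr (1/t) \<le> c"
      and cB: "lambda1 (B * minv Q * mat_adjoint B) powr (1/p) \<le> c" by (auto simp: c_def)
    have "0 < lambda1 (A * minv Q * mat_adjoint A) powr (1/t)" using LA(1) by simp
    then have c: "c > 0" using cA by linarith
    \<comment> \<open>The share of \<open>Q\<close> left for the term m^s I; with k^(-t) and k^(-p)
      it adds up to 1.\<close>
    define \<kappa> where "\<kappa> = 1 - k powr (-t) - k powr (-p)"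
    have \<kappa>: "\<kappa> > 0" using assms(8) by (simp add: \<kappa>_def)
    \<comment> \<open>The three bounds proved inside are the shares k^(-t), k^(-p) and
      \<open>\<kappa>\<close> of the form of \<open>Q\<close>; their sum is the domination
      inequality.\<close>
    interpret dominated_equation n A B Q s t p "k * c"
    proof
      fix v :: "complex vec" assume v: "v \<in> carrier_vec n"
      have qv: "0 \<le> qform Q v"
        unfolding diagonalizes_qform[OF q v] using q0 by (intro sum_nonneg mult_nonneg_nonneg) (auto intro: less_imp_le)
      have 1: "(k * c) powr (- t) * (vnorm (A *\<^sub>v v))\<^sup>2 \<le> k powr (- t) * qform Q v"
        using LA(1) by (intro powr_neg_mult_le[OF assms(7) c assms(2) _ cA LA(2)[OF v] qv]) simp
      have 2: "(k * c) powr (- p) * (vnorm (B *\<^sub>v v))\<^sup>2 \<le> k powr (- p) * qform Q v"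
        using LB(1) by (intro powr_neg_mult_le[OF assms(7) c assms(3) _ cB LB(2)[OF v] qv]) simp
      have "c powr s * (vnorm v)\<^sup>2 \<le> \<kappa> * k powr (- s) * qform Q v"
        using c \<kappa> assms(7,9) by (intro qform_ge_of_lambda1_minv[OF assms(6) _ _ _ v]) (auto simp: c_def \<kappa>_def)
      then have "k powr s * (c powr s * (vnorm v)\<^sup>2) \<le> k powr s * (\<kappa> * k powr (- s) * qform Q v)"
        by (intro mult_left_mono) auto
      also have "\<dots> = (k powr s * k powr (- s)) * \<kappa> * qform Q v" by (simp add: mult_ac)
      also have "k powr s * k powr (- s) = 1" using assms(7) by (simp flip: powr_add)
      finally have 3: "(k * c) powr s * (vnorm v)\<^sup>2 \<le> \<kappa> * qform Q v"
        using assms(7) c by (simp add: powr_mult mult_ac)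
      have "\<kappa> * qform Q v = qform Q v - k powr (- t) * qform Q v - k powr (- p) * qform Q v"
        by (simp add: \<kappa>_def algebra_simps)
      then show "(k * c) powr s * (vnorm v)\<^sup>2 + (k * c) powr (- t) * (vnorm (A *\<^sub>v v))\<^sup>2
          + (k * c) powr (- p) * (vnorm (B *\<^sub>v v))\<^sup>2 \<le> qform Q v"
        using 1 2 3 by linarith
    qed (use assms Ac Bc c in auto)
    obtain X where X: "X \<in> loewner_interval n (complex_of_real (k * c) \<cdot>\<^sub>m 1\<^sub>m n) (mpow Q (1/s))" "pd_mat n X"
      and sol: "mpow X s + mat_adjoint A * mpow (minv X) t * A + mat_adjoint B * mpow (minv X) p * B = Q"
      using exists_solution by blast
    have "Y = X"
      if "(1/s) * (k * c) powr (1 - s) *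
            (t / (k * c) powr (t + 1) * (spec_norm A)\<^sup>2 + p / (k * c) powr (p + 1) * (spec_norm B)\<^sup>2) < 1"
        and "Y \<in> loewner_interval n (complex_of_real (k * c) \<cdot>\<^sub>m 1\<^sub>m n) (mpow Q (1/s))"
        and "mpow Y s + mat_adjoint A * mpow (minv Y) t * A + mat_adjoint B * mpow (minv Y) p * B = Q" for Y
      using solution_unique[OF that(1) _ _ sol that(3)] X(1) that(2) by (simp add: loewner_interval_def)
    then show ?thesis
      using scalar_le_root X sol unfolding Let_def c_def[symmetric] by blast
  qed
qed

end
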